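(* Let $A$ be a unital commutative (von Neumann) regular algebra over $\mathbb{C}$ and let $\mu$ be a finite strictly positive countably additive measure on the Boolean algebra $\nabla$ of all idempotents of $A$. Suppose that $A$ is complete in the metric $\rho(a,b)=\mu(s(a-b))$, $a,b\in A$. Then the following conditions are equivalent: (i) $K_c(\nabla)\neq A$; (ii) the algebra $A$ admits a non-zero derivation; (iii) the algebra $A$ admits a non-zero local derivation; (iv) the algebra $A$ admits a local derivation which is not a derivation.
   Context: An algebra $A$ is regular (in the sense of von Neumann) if for every $a\in A$ there is $b\in A$ with $a=aba$. Let $A$ be a unital commutative regular algebra over $\mathbb{C}$ with unit $\mathbf{1}$. The set $\nabla=\{e\in A:e^2=e\}$ is a Boolean algebra with order $e\le f\iff ef=e$, operations $e\vee f=e+f-ef$, $e\wedge f=ef$, and complement $e^\perp=\mathbf{1}-e$. For each $a\in A$ the support $s(a)$ is the least idempotent $e\in\nabla$ with $ea=a$ (it exists by regularity). A measure $\mu$ on $\nabla$ is strictly positive if $\mu(e)>0$ for all $e\neq 0$. $K_c(\nabla)$ denotes the set of countably valued elements of $A$, i.e. elements of the form $a=\sum_{k=1}^{\omega}\alpha_ke_k$, where $\omega\in\mathbb{N}$ or $\omega=\infty$, $\alpha_k\in\mathbb{C}$, $e_k\in\nabla$, $e_ke_j=0$ for $k\ne j$; if $\omega=\infty$ the convergence of the series is with respect to the metric $\rho$. A derivation on $A$ is a linear operator $D:A\to A$ with $D(xy)=D(x)y+xD(y)$ for all $x,y\in A$. A local derivation on $A$ is a linear operator $\Delta:A\to A$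 such that for each $x\in A$ there is a derivation $D$ on $A$ (depending on $x$) with $\Delta(x)=D(x)$. *)

theory Defs
  imports "HOL-Analysis.Analysis"
begin

text \<open>The left-hand compatibility axiom suffices because multiplication is commutative.\<close>

locale complex_algebra = vector_space cscale
  for cscale :: "complex \<Rightarrow> 'a::comm_ring_1 \<Rightarrow> 'a" +
  assumes scale_mult_left: "cscale c x * y = cscale c (x * y)"

definition von_neumann_regular :: "'a::comm_ring_1 itself \<Rightarrow> bool" where
  "von_neumann_regular _ \<longleftrightarrow> (\<forall>a::'a. \<exists>b. a = a * b * a)"

definition idempotents :: "'a::comm_ring_1 set" where
  "idempotents = {e. e\<^sup>2 = e}"

definition idem_le :: "'a::comm_ring_1 \<Rightarrow> 'a \<Rightarrow> bool" where
  "idem_le e f \<longleftrightarrow> e * f = e"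

definition is_idem_sup :: "(nat \<Rightarrow> 'a::comm_ring_1) \<Rightarrow> 'a \<Rightarrow> bool" where
  "is_idem_sup e g \<longleftrightarrow> g \<in> idempotents \<and> (\<forall>n. idem_le (e n) g) \<and>
     (\<forall>f\<in>idempotents. (\<forall>n. idem_le (e n) f) \<longrightarrow> idem_le g f)"

definition is_support :: "'a::comm_ring_1 \<Rightarrow> 'a \<Rightarrow> bool" where
  "is_support a e \<longleftrightarrow> e \<in> idempotents \<and> e * a = a \<and>
     (\<forall>f\<in>idempotents. f * a = a \<longrightarrow> idem_le e f)"

definition supp :: "'a::comm_ring_1 \<Rightarrow> 'a" where
  "supp a = (THE e. is_support a e)"

text \<open>
  The Boolean algebra of idempotents is not assumed to be countably complete, so countable
  additivity refers to those disjoint sequences whose supremum exists; constant tails equal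
  to zero give finite additivity and \<open>\<mu> 0 = 0\<close>. Finiteness of the measure is expressed by its
  being real-valued. The values of \<open>\<mu>\<close> outside the idempotents are irrelevant.
\<close>

definition finite_measure_on_idempotents :: "('a::comm_ring_1 \<Rightarrow> real) \<Rightarrow> bool" where
  "finite_measure_on_idempotents \<mu> \<longleftrightarrow>
     (\<forall>e\<in>idempotents. 0 \<le> \<mu> e) \<and>
     (\<forall>e g. (\<forall>n. e n \<in> idempotents) \<and> (\<forall>m n. m \<noteq> n \<longrightarrow> e m * e n = 0) \<and> is_idem_sup e g
        \<longrightarrow> (\<lambda>n. \<mu> (e n)) sums \<mu> g)"

definition strictly_positive :: "('a::comm_ring_1 \<Rightarrow> real) \<Rightarrow> bool" where
  "strictly_positive \<mu> \<longleftrightarrow> (\<forall>e\<in>idempotents. e \<noteq> 0 \<longrightarrow> 0 < \<mu> e)"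

definition rho :: "('a::comm_ring_1 \<Rightarrow> real) \<Rightarrow> 'a \<Rightarrow> 'a \<Rightarrow> real" where
  "rho \<mu> a b = \<mu> (supp (a - b))"

definition countably_valued ::
    "(complex \<Rightarrow> 'a::comm_ring_1 \<Rightarrow> 'a) \<Rightarrow> ('a \<Rightarrow> real) \<Rightarrow> 'a set" where
  "countably_valued cscale \<mu> =
     {a. \<exists>(n::nat) \<alpha> e.
           (\<forall>k<n. e k \<in> idempotents) \<and> (\<forall>j<n. \<forall>k<n. k \<noteq> j \<longrightarrow> e k * e j = 0) \<and>
           a = (\<Sum>k<n. cscale (\<alpha> k) (e k))} \<union>
     {a. \<exists>\<alpha> e.
           (\<forall>k. e k \<in> idempotents) \<and> (\<forall>j k. k \<noteq> j \<longrightarrow> e k * e j = 0) \<and>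
           limitin (Metric_space.mtopology UNIV (rho \<mu>))
             (\<lambda>n. \<Sum>k<n. cscale (\<alpha> k) (e k)) a sequentially}"

definition derivation ::
    "(complex \<Rightarrow> 'a::comm_ring_1 \<Rightarrow> 'a) \<Rightarrow> ('a \<Rightarrow> 'a) \<Rightarrow> bool" where
  "derivation cscale D \<longleftrightarrow>
     Vector_Spaces.linear cscale cscale D \<and> (\<forall>x y. D (x * y) = D x * y + x * D y)"

definition local_derivation ::
    "(complex \<Rightarrow> 'a::comm_ring_1 \<Rightarrow> 'a) \<Rightarrow> ('a \<Rightarrow> 'a) \<Rightarrow> bool" where
  "local_derivation cscale \<Delta> \<longleftrightarrow>
     Vector_Spaces.linear cscale cscale \<Delta> \<and> (\<forall>x. \<exists>D. derivation cscale D \<and> \<Delta> x = D x)"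

lemma idempotents_iff: "e \<in> idempotents \<longleftrightarrow> e * e = e"
  by (simp add: idempotents_def power2_eq_square)

lemma is_support_unique: "is_support a e \<Longrightarrow> is_support a f \<Longrightarrow> e = f"
  unfolding is_support_def idem_le_def by (metis mult.commute)

lemma is_support_supp:
  assumes "von_neumann_regular TYPE('a::comm_ring_1)"
  shows "is_support (a::'a) (supp a)"
proof -
  obtain b where b: "a = a * b * a"
    using assms unfolding von_neumann_regular_def by blast
  have "is_support a (a * b)"
    unfolding is_support_def idempotents_iff idem_le_def
  proof (intro conjI ballI impI)
    show "a * b * (a * b) = a * b"
      using b by (simp add: mult.assoc[symmetric])
    show "a * b * a = a"
      using b by simp
    fix f assume "f * a = a"
    then show "a * b * f = a * b"
      by (metis mult.assoc mult.commute)
  qed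
  then show ?thesis
    unfolding supp_def by (rule theI) (use \<open>is_support a (a * b)\<close> is_support_unique in blast)
qed

lemma finite_measure_on_idempotents_zero:
  assumes "finite_measure_on_idempotents \<mu>"
  shows "\<mu> 0 = 0"
proof -
  have "is_idem_sup (\<lambda>n::nat. 0) (0::'a)"
    by (auto simp: is_idem_sup_def idempotents_iff idem_le_def)
  then have "(\<lambda>n. \<mu> 0) sums \<mu> 0"
    using assms unfolding finite_measure_on_idempotents_def
    by (elim conjE allE[of _ "\<lambda>n. 0"] allE[of _ 0]) (auto simp: idempotents_iff)
  then show ?thesis
    using sums_summable summable_const_iff by blast
qed

lemma finite_measure_on_idempotents_add:
  assumes \<mu>: "finite_measure_on_idempotents \<mu>"
    and e: "e \<in> idempotents" and f: "f \<in> idempotents" and ef: "e * f = 0"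
  shows "\<mu> (e + f) = \<mu> e + \<mu> f"
proof -
  define s where "s = (\<lambda>n::nat. if n = 0 then e else if n = 1 then f else 0)"
  have ee: "e * e = e" and ff: "f * f = f" and fe: "f * e = 0"
    using e f ef by (auto simp: idempotents_iff mult.commute)
  have "is_idem_sup s (e + f)"
    unfolding is_idem_sup_def
  proof (intro conjI ballI impI allI)
    show "e + f \<in> idempotents"
      by (simp add: idempotents_iff algebra_simps ee ff ef fe)
    show "idem_le (s n) (e + f)" for n
      by (auto simp: s_def idem_le_def algebra_simps ee ff ef fe)
    fix h assume "\<forall>n. idem_le (s n) h"
    from this[rule_format, of 0] this[rule_format, of 1]
    show "idem_le (e + f) h"
      by (simp add: s_def idem_le_def algebra_simps)
  qed
  moreover have "\<forall>n. s n \<in> idempotents" "\<forall>m n. m \<noteq> n \<longrightarrow> s m * s n = 0"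
    by (auto simp: s_def idempotents_iff ee ff ef fe)
  ultimately have "(\<lambda>n. \<mu> (s n)) sums \<mu> (e + f)"
    using \<mu> unfolding finite_measure_on_idempotents_def by blast
  moreover have "(\<lambda>n. \<mu> (s n)) sums (\<Sum>n\<in>{0,1}. \<mu> (s n))"
    by (rule sums_finite)
      (auto simp: s_def finite_measure_on_idempotents_zero[OF \<mu>])
  ultimately show ?thesis
    using sums_unique2 by (fastforce simp: s_def)
qed

lemma finite_measure_on_idempotents_mono:
  assumes \<mu>: "finite_measure_on_idempotents \<mu>"
    and e: "e \<in> idempotents" and f: "f \<in> idempotents" and "idem_le e f"
  shows "\<mu> e \<le> \<mu> f"
proof -
  have h: "e * e = e" "f * f = f" "e * f = e" "f * e = e"
    using assms by (auto simp: idempotents_iff idem_le_def mult.commute)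
  have d: "f - e \<in> idempotents" by (simp add: idempotents_iff algebra_simps h)
  have "\<mu> (e + (f - e)) = \<mu> e + \<mu> (f - e)"
    by (rule finite_measure_on_idempotents_add[OF \<mu> e d]) (simp add: algebra_simps h)
  moreover have "0 \<le> \<mu> (f - e)"
    using \<mu> d unfolding finite_measure_on_idempotents_def by blast
  ultimately show ?thesis by simp
qed

lemma Metric_space_rho:
  fixes \<mu> :: "'a::comm_ring_1 \<Rightarrow> real"
  assumes reg: "von_neumann_regular TYPE('a)"
    and \<mu>: "finite_measure_on_idempotents \<mu>" and pos: "strictly_positive \<mu>"
  shows "Metric_space UNIV (rho \<mu>)"
proof
  note S = is_support_supp[OF reg, unfolded is_support_def]
  have supp_eq: "supp (a::'a) = e" if "is_support a e" for a e
    using that is_support_supp[OF reg] is_support_unique by blast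
  fix x y z :: 'a
  show "0 \<le> rho \<mu> x y"
    using S[of "x - y"] \<mu> unfolding rho_def finite_measure_on_idempotents_def by blast
  have "is_support (x - y) (supp (y - x))"
    using S[of "y - x"] unfolding is_support_def
    by (metis minus_diff_eq mult_minus_right)
  then show "rho \<mu> x y = rho \<mu> y x"
    by (simp add: rho_def supp_eq)
  have "supp (0::'a) = 0"
    by (rule supp_eq) (simp add: is_support_def idempotents_iff idem_le_def)
  then show "rho \<mu> x y = 0 \<longleftrightarrow> x = y"
    using S[of "x - y"] pos finite_measure_on_idempotents_zero[OF \<mu>]
    unfolding rho_def strictly_positive_def
    by (metis diff_self eq_iff_diff_eq_0 less_irrefl mult_zero_left)
  define e f where "e = supp (x - y)" and "f = supp (y - z)"
  have e: "e * e = e" "e * (x - y) = x - y" and f: "f * f = f" "f * (y - z) = y - z"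
    using S[of "x - y"] S[of "y - z"] by (auto simp: e_def f_def idempotents_iff)
  define g where "g = f - e * f"
  have ee: "e * (e * u) = e * u" and ff: "f * (f * u) = f * u" for u
    by (simp_all add: mult.assoc[symmetric] e(1) f(1))
  have g: "g * g = g" "e * g = 0"
    unfolding g_def by (simp_all add: algebra_simps ee ff e(1) f(1))
  have eg: "e + g \<in> idempotents"
    using g e by (simp add: idempotents_iff algebra_simps)
  have 1: "(e + g) * (x - y) = x - y"
  proof -
    have "(e + g) * e = e" using e(1) g(2) by (simp add: algebra_simps)
    then show ?thesis using e(2) by (metis mult.assoc)
  qed
  have 2: "(e + g) * (y - z) = y - z"
  proof -
    have "(e + g) * f = f" unfolding g_def using f(1) by (simp add: algebra_simps)
    then show ?thesis using f(2) by (metis mult.assoc)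
  qed
  have "(e + g) * (x - z) = x - z"
    using arg_cong2[OF 1 2, of "(+)"] by (simp add: algebra_simps)
  then have "idem_le (supp (x - z)) (e + g)"
    using S[of "x - z"] eg by blast
  then have "rho \<mu> x z \<le> \<mu> (e + g)"
    unfolding rho_def using finite_measure_on_idempotents_mono[OF \<mu> _ eg] S[of "x - z"] by blast
  also have "\<dots> = \<mu> e + \<mu> g"
    by (rule finite_measure_on_idempotents_add[OF \<mu>]) (use e g in \<open>auto simp: idempotents_iff\<close>)
  also have "\<mu> g \<le> \<mu> f"
  proof (rule finite_measure_on_idempotents_mono[OF \<mu>])
    show "idem_le g f" using f(1) by (simp add: idem_le_def g_def algebra_simps)
  qed (use f g in \<open>auto simp: idempotents_iff\<close>)
  finally show "rho \<mu> x z \<le> rho \<mu> x y + rho \<mu> y z"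
    by (simp add: rho_def e_def f_def)
qed

end

theory Submission
  imports Defs "HOL-Computational_Algebra.Fundamental_Theorem_Algebra"
begin

text \<open>
  A derivation \<open>D\<close> kills every idempotent, hence \<open>D a = s(a) D a\<close>. So \<open>D\<close> does not increase supports,
  it is \<open>\<rho>\<close>-contractive, and it vanishes on the countably valued elements. A local derivation that
  is not a derivation is non-zero, and wherever a local derivation is non-zero so is some derivation.
  This leaves the implication from \<open>K\<^sub>c(\<nabla>) \<noteq> A\<close> to the existence of a local derivation that is not a
  derivation.

  Every \<open>x\<close> splits along an idempotent \<open>c\<close>: the part \<open>c x\<close> is countably valued, and on
  \<open>t = 1 - c\<close> the element \<open>x\<close> is nowhere constant, that is, no non-zero idempotent \<open>f \<le> t\<close> satisfies
  \<open>f x = \<alpha> f\<close> (\<open>countably_valued_part\<close>; the measure enters because only countably many disjoint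
  idempotents can be non-zero). The central result \<open>derivation_exists\<close> produces a derivation \<open>D\<close> with
  \<open>D x = t\<close>. If \<open>x\<close> is not countably valued, then \<open>t \<noteq> 0\<close> and \<open>D\<close> is non-zero. In that case
  \<open>D \<circ> D\<close> is not a derivation, because its failure to satisfy the Leibniz rule at \<open>(x, x)\<close> is
  \<open>2 (D x)\<^sup>2\<close>. It is a local derivation: given \<open>y\<close> with its splitting \<open>t\<^sub>y\<close> and a derivation \<open>E\<close> with
  \<open>E y = t\<^sub>y\<close>, the derivation \<open>D (D y) \<cdot> E\<close> agrees with \<open>D \<circ> D\<close> at \<open>y\<close>, since
  \<open>D (D y)\<close> lives on \<open>t\<^sub>y\<close>.

  For \<open>derivation_exists\<close>, a derivation on a subalgebra is regarded as its graph, which is a subring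
  of the dual numbers \<open>A[\<epsilon>]\<close> (\<open>(a, d)\<close> stands for \<open>a + d \<epsilon>\<close>), and Zorn's lemma gives a maximal
  graph containing \<open>(x, t)\<close>. To extend a graph to a further element \<open>y\<close> one must choose the value \<open>z\<close>
  of the derivation at \<open>y\<close> so that the linear equations \<open>p'(y) z = - q(y)\<close> hold, one for each
  polynomial \<open>p + q \<epsilon>\<close> over the graph with \<open>p(y) = 0\<close>. Modulo a prime ideal the algebra becomes a field
  of characteristic \<open>0\<close>, where the classical extension of derivations along a simple field extension
  solves the system (\<open>adjoin_consistent_mod_prime\<close>). Completeness in \<open>\<rho>\<close> glues these solutions: a
  linear system over \<open>A\<close> in one unknown that is solvable modulo every prime ideal is solvable
  (\<open>linear_system_local_global\<close>). The last point is essentially Baer's criterion, saying that \<open>A\<close>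
  is an injective module over itself.
\<close>


section \<open>Prime ideals\<close>

definition prime_ideal :: "'a::comm_ring_1 set \<Rightarrow> bool" where
  "prime_ideal P \<longleftrightarrow> 0 \<in> P \<and> 1 \<notin> P \<and> (\<forall>a\<in>P. \<forall>b\<in>P. a + b \<in> P) \<and>
     (\<forall>a\<in>P. \<forall>b. a * b \<in> P) \<and> (\<forall>a b. a * b \<in> P \<longrightarrow> a \<in> P \<or> b \<in> P)"

lemma prime_idealD:
  assumes "prime_ideal P"
  shows "0 \<in> P" "1 \<notin> P" "a \<in> P \<Longrightarrow> b \<in> P \<Longrightarrow> a + b \<in> P"
    "a \<in> P \<Longrightarrow> a * b \<in> P" "b \<in> P \<Longrightarrow> a * b \<in> P" "a * b \<in> P \<Longrightarrow> a \<notin> P \<Longrightarrow> b \<in> P"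
    "a \<in> P \<Longrightarrow> - a \<in> P" "a \<in> P \<Longrightarrow> b \<in> P \<Longrightarrow> a - b \<in> P"
proof -
  show *: "0 \<in> P" "1 \<notin> P" "a \<in> P \<Longrightarrow> b \<in> P \<Longrightarrow> a + b \<in> P" for a b
    using assms by (auto simp: prime_ideal_def)
  show m: "a \<in> P \<Longrightarrow> a * b \<in> P" for a b
    using assms by (auto simp: prime_ideal_def)
  show "b \<in> P \<Longrightarrow> a * b \<in> P" "a * b \<in> P \<Longrightarrow> a \<notin> P \<Longrightarrow> b \<in> P"
    using assms by (auto simp: prime_ideal_def mult.commute)
  show n: "- a \<in> P" if "a \<in> P" for a
    using m[OF that, of "- 1"] by simp
  show "a - b \<in> P" if "a \<in> P" "b \<in> P"
    using *(3)[OF that(1) n[OF that(2)]] by simp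
qed

lemma prime_ideal_sum:
  assumes "prime_ideal P" "\<And>i. i \<in> I \<Longrightarrow> f i \<in> P"
  shows "sum f I \<in> P"
  using assms(2) by (induction I rule: infinite_finite_induct) (auto intro: prime_idealD(1,3)[OF assms(1)])

lemma prime_ideal_poly:
  assumes "prime_ideal P" "\<And>i. coeff p i \<in> P"
  shows "poly p y \<in> P"
  unfolding poly_altdef by (intro prime_ideal_sum prime_idealD(4)) (use assms in auto)

text \<open>
  An ideal maximal among those avoiding \<open>e\<close> is prime. If neither \<open>a\<close> nor \<open>b\<close> belongs to it, then \<open>e\<close>
  lies in both enlarged ideals, and \<open>e = e\<^sup>2\<close> puts \<open>e\<close> into the ideal enlarged by \<open>a b\<close>.
\<close>

lemma prime_ideal_avoiding_idempotent:
  fixes e :: "'a::comm_ring_1"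
  assumes e: "e * e = e" and ne: "e \<noteq> 0"
  shows "\<exists>P. prime_ideal P \<and> e \<notin> P"
proof -
  define \<I> where "\<I> = {I :: 'a set. 0 \<in> I \<and> e \<notin> I \<and> (\<forall>a\<in>I. \<forall>b\<in>I. a + b \<in> I) \<and> (\<forall>a\<in>I. \<forall>b. a * b \<in> I)}"
  have "{0} \<in> \<I>" using ne by (simp add: \<I>_def)
  then have "\<I> \<noteq> {}" by blast
  moreover have "\<Union>C \<in> \<I>" if "C \<noteq> {}" and C: "subset.chain \<I> C" for C
  proof -
    have "a + b \<in> \<Union>C" if ab: "a \<in> \<Union>C" "b \<in> \<Union>C" for a b
    proof -
      obtain X Y where XY: "X \<in> C" "Y \<in> C" "a \<in> X" "b \<in> Y" using ab by blast
      then have "X \<subseteq> Y \<or> Y \<subseteq> X" "X \<in> \<I>" "Y \<in> \<I>"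
        using C by (auto simp: subset.chain_def)
      then have "a + b \<in> X \<or> a + b \<in> Y" using XY(3,4) unfolding \<I>_def by blast
      then show ?thesis using XY(1,2) by blast
    qed
    moreover have "X \<in> \<I>" if "X \<in> C" for X
      using C that by (auto simp: subset.chain_def)
    ultimately show ?thesis using \<open>C \<noteq> {}\<close> unfolding \<I>_def by blast
  qed
  ultimately obtain P where P: "P \<in> \<I>" and max: "\<And>X. X \<in> \<I> \<Longrightarrow> P \<subseteq> X \<Longrightarrow> X = P"
    using subset_Zorn_nonempty[of \<I>] by blast
  have P': "0 \<in> P" "e \<notin> P" "\<And>a b. a \<in> P \<Longrightarrow> b \<in> P \<Longrightarrow> a + b \<in> P" "\<And>a b. a \<in> P \<Longrightarrow> a * b \<in> P"
    using P by (auto simp: \<I>_def)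
  have generate: "\<exists>p\<in>P. \<exists>c. e = p + a * c" if a: "a \<notin> P" for a
  proof (rule ccontr)
    assume no: "\<not> ?thesis"
    define X where "X = {p + a * c | p c. p \<in> P}"
    have "X \<in> \<I>"
      unfolding \<I>_def
    proof (intro CollectI conjI ballI allI)
      show "0 \<in> X" unfolding X_def using P'(1) by (auto intro!: exI[of _ 0])
      show "e \<notin> X" using no unfolding X_def by blast
      show "u + v \<in> X" if uv: "u \<in> X" "v \<in> X" for u v
      proof -
        obtain p c p' c' where "u = p + a * c" "v = p' + a * c'" "p \<in> P" "p' \<in> P"
          using uv unfolding X_def by blast
        then have "u + v = (p + p') + a * (c + c')" "p + p' \<in> P"
          using P'(3) by (simp_all add: algebra_simps)
        then show ?thesis unfolding X_def by blast
      qed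
      show "u * b \<in> X" if u: "u \<in> X" for u b
      proof -
        obtain p c where "u = p + a * c" "p \<in> P" using u unfolding X_def by blast
        then have "u * b = p * b + a * (c * b)" "p * b \<in> P"
          using P'(4)[of p b] by (simp_all add: algebra_simps)
        then show ?thesis unfolding X_def by blast
      qed
    qed
    moreover     have "P \<subseteq> X"
    proof
      fix p assume "p \<in> P"
      moreover have "p = p + a * 0" by simp
      ultimately show "p \<in> X" unfolding X_def by blast
    qed
    ultimately have "X = P" by (rule max)
    moreover have "a = 0 + a * 1" by simp
    then have "a \<in> X" unfolding X_def using P'(1) by blast
    ultimately show False using a by simp
  qed
  have "a \<in> P \<or> b \<in> P" if ab: "a * b \<in> P" for a b
  proof (rule ccontr)
    assume "\<not> ?thesis"
    then obtain p c q d where pq: "p \<in> P" "q \<in> P" and e1: "e = p + a * c" and e2: "e = q + b * d"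
      using generate by meson
    have "e = (p + a * c) * (q + b * d)" using e e1 e2 by metis
    also have "\<dots> = p * (q + b * d) + (q * (a * c) + a * b * (c * d))" by (simp add: algebra_simps)
    finally show False using P' pq ab by metis
  qed
  moreover have "1 \<notin> P" using P'(2) P'(4)[of 1 e] by auto
  ultimately have "prime_ideal P" using P' by (auto simp: prime_ideal_def)
  then show ?thesis using P'(2) by blast
qed

lemma prime_ideal_avoiding:
  fixes v :: "'a::comm_ring_1"
  assumes reg: "von_neumann_regular TYPE('a)" and "v \<noteq> 0"
  shows "\<exists>P. prime_ideal P \<and> v \<notin> P"
proof -
  obtain b where b: "v = v * b * v"
    using reg unfolding von_neumann_regular_def by blast
  have "v * b * (v * b) = v * b" using b by (metis mult.assoc)
  moreover have "v * b \<noteq> 0" using b \<open>v \<noteq> 0\<close> by auto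
  ultimately show ?thesis
    using prime_ideal_avoiding_idempotent[of "v * b"] prime_idealD(4) by blast
qed

text \<open>
  Prime ideals of a regular ring are maximal, because \<open>a (1 - a b) = 0\<close> whenever \<open>a = a b a\<close>; working
  modulo \<open>P\<close> therefore means working in a field.
\<close>

lemma prime_ideal_inverse:
  fixes a :: "'a::comm_ring_1"
  assumes reg: "von_neumann_regular TYPE('a)" and P: "prime_ideal P" and "a \<notin> P"
  shows "\<exists>b. 1 - a * b \<in> P"
proof -
  obtain b where b: "a = a * b * a"
    using reg unfolding von_neumann_regular_def by blast
  then have "a * (1 - a * b) = 0" by (simp add: algebra_simps)
  then show ?thesis using prime_idealD(1,6)[OF P] \<open>a \<notin> P\<close> by metis
qed


section \<open>Adjoining an element to a partial derivation\<close>

text \<open>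
  A subring of the dual numbers, with \<open>(a, d)\<close> standing for \<open>a + d \<epsilon>\<close> and \<open>\<epsilon>\<^sup>2 = 0\<close>. An additive map
  \<open>D\<close> on a subring is a derivation precisely when its graph is closed under this multiplication.
\<close>

definition dual_subring :: "('a::comm_ring_1 \<times> 'a) set \<Rightarrow> bool" where
  "dual_subring G \<longleftrightarrow> (1, 0) \<in> G \<and> (-1, 0) \<in> G \<and>
     (\<forall>a d b e. (a, d) \<in> G \<longrightarrow> (b, e) \<in> G \<longrightarrow> (a + b, d + e) \<in> G \<and> (a * b, a * e + d * b) \<in> G)"

lemma dual_subringD:
  assumes "dual_subring G"
  shows "(1, 0) \<in> G" "(0, 0) \<in> G"
    "(a, d) \<in> G \<Longrightarrow> (b, e) \<in> G \<Longrightarrow> (a + b, d + e) \<in> G"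
    "(a, d) \<in> G \<Longrightarrow> (b, e) \<in> G \<Longrightarrow> (a * b, a * e + d * b) \<in> G"
    "(a, d) \<in> G \<Longrightarrow> (b, e) \<in> G \<Longrightarrow> (a - b, d - e) \<in> G"
    "(a, d) \<in> G \<Longrightarrow> (of_nat n * a, of_nat n * d) \<in> G"
proof -
  show one: "(1, 0) \<in> G"
    and add: "(a, d) \<in> G \<Longrightarrow> (b, e) \<in> G \<Longrightarrow> (a + b, d + e) \<in> G"
    and mul: "(a, d) \<in> G \<Longrightarrow> (b, e) \<in> G \<Longrightarrow> (a * b, a * e + d * b) \<in> G" for a b d e
    using assms by (auto simp: dual_subring_def)
  have neg: "(-1, 0) \<in> G" using assms by (auto simp: dual_subring_def)
  show zero: "(0, 0) \<in> G" using add[OF one neg] by simp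
  show "(a - b, d - e) \<in> G" if "(a, d) \<in> G" "(b, e) \<in> G"
    using add[OF that(1) mul[OF neg that(2)]] by simp
  show "(of_nat n * a, of_nat n * d) \<in> G" if "(a, d) \<in> G"
  proof (induction n)
    case (Suc n)
    then show ?case using add[OF that Suc] by (simp add: algebra_simps)
  qed (simp add: zero)
qed

lemma dual_subring_sum:
  assumes "dual_subring G" "\<And>i. i \<in> I \<Longrightarrow> (f i, g i) \<in> G"
  shows "(sum f I, sum g I) \<in> G"
  using assms(2) by (induction I rule: infinite_finite_induct) (auto simp: dual_subringD[OF assms(1)])

text \<open>
  Idempotents are zero divisors, so the ring is outside the type class on which \<open>pderiv\<close> is defined;
  the formal derivative makes sense over every commutative ring.
\<close>

definition formal_deriv :: "'a::comm_ring_1 poly \<Rightarrow> 'a poly" where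
  "formal_deriv p = Abs_poly (\<lambda>n. of_nat (Suc n) * coeff p (Suc n))"

lemma coeff_formal_deriv: "coeff (formal_deriv p) n = of_nat (Suc n) * coeff p (Suc n)"
  unfolding formal_deriv_def by (rule coeff_Abs_poly[of "degree p", THEN fun_cong]) (simp add: coeff_eq_0)

lemma formal_deriv_linear:
  "formal_deriv (p + q) = formal_deriv p + formal_deriv q"
  "formal_deriv (p - q) = formal_deriv p - formal_deriv q"
  "formal_deriv (smult c p) = smult c (formal_deriv p)"
  by (intro poly_eqI; simp add: coeff_formal_deriv algebra_simps)+

lemma formal_deriv_pCons: "formal_deriv (pCons a p) = p + pCons 0 (formal_deriv p)"
  by (intro poly_eqI) (auto simp: coeff_formal_deriv coeff_pCons algebra_simps split: nat.splits)

lemma formal_deriv_0: "formal_deriv 0 = 0"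
  by (intro poly_eqI) (simp add: coeff_formal_deriv)

lemma formal_deriv_mult: "formal_deriv (p * q) = p * formal_deriv q + formal_deriv p * q"
  by (induction p)
    (simp_all add: formal_deriv_0 formal_deriv_pCons formal_deriv_linear algebra_simps)

text \<open>
  The pair \<open>(p, q)\<close> encodes the polynomial \<open>p + q \<epsilon>\<close> with coefficients in \<open>G\<close>.
\<close>

definition dual_poly :: "('a::comm_ring_1 \<times> 'a) set \<Rightarrow> 'a poly \<Rightarrow> 'a poly \<Rightarrow> bool" where
  "dual_poly G p q \<longleftrightarrow> (\<forall>i. (coeff p i, coeff q i) \<in> G)"

text \<open>
  These pairs are the values of polynomials over \<open>G\<close> at the dual number \<open>y + z \<epsilon>\<close>, by the Taylor
  expansion \<open>p(y + z \<epsilon>) = p(y) + p'(y) z \<epsilon>\<close>. The result is the subring generated by \<open>G\<close> and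
  \<open>(y, z)\<close>: if \<open>G\<close> is the graph of a derivation, the extended derivation is to send \<open>y\<close> to \<open>z\<close>.
\<close>

definition adjoin :: "('a::comm_ring_1 \<times> 'a) set \<Rightarrow> 'a \<Rightarrow> 'a \<Rightarrow> ('a \<times> 'a) set" where
  "adjoin G y z = {(poly p y, poly q y + poly (formal_deriv p) y * z) | p q. dual_poly G p q}"

context
  fixes G :: "('a::comm_ring_1 \<times> 'a) set"
  assumes G: "dual_subring G"
begin

lemma dual_poly_arith:
  assumes "dual_poly G p q" "dual_poly G p' q'"
  shows "dual_poly G (p + p') (q + q')" "dual_poly G (p - p') (q - q')"
    "dual_poly G (p * p') (p * q' + q * p')"
  using assms unfolding dual_poly_def
  by (auto simp: coeff_mult sum.distrib[symmetric] intro!: dual_subringD[OF G] dual_subring_sum[OF G])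

lemma dual_poly_monom: "(a, d) \<in> G \<Longrightarrow> dual_poly G (monom a n) (monom d n)"
  by (simp add: dual_poly_def dual_subringD[OF G])

lemma dual_poly_formal_deriv: "dual_poly G p q \<Longrightarrow> dual_poly G (formal_deriv p) (formal_deriv q)"
  unfolding dual_poly_def coeff_formal_deriv using dual_subringD(6)[OF G] by blast

lemma adjoin_contains: "G \<subseteq> adjoin G y z" "(y, z) \<in> adjoin G y z"
proof -
  have "(a, d) \<in> adjoin G y z" if "(a, d) \<in> G" for a d
    unfolding adjoin_def using dual_poly_monom[OF that, of 0]
    by (intro CollectI exI[of _ "[:a:]"] exI[of _ "[:d:]"])
      (simp add: monom_0 formal_deriv_pCons formal_deriv_0)
  then show "G \<subseteq> adjoin G y z" by auto
  show "(y, z) \<in> adjoin G y z"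
    unfolding adjoin_def using dual_poly_monom[OF dual_subringD(1)[OF G], of 1]
    by (intro CollectI exI[of _ "[:0, 1:]"] exI[of _ 0])
      (simp add: monom_Suc monom_0 formal_deriv_pCons formal_deriv_0)
qed

lemma dual_subring_adjoin: "dual_subring (adjoin G y z)"
  unfolding dual_subring_def
proof (intro conjI allI impI)
  show "(1, 0) \<in> adjoin G y z" "(- 1, 0) \<in> adjoin G y z"
    using adjoin_contains(1) G unfolding dual_subring_def by blast+
  fix a d b e assume "(a, d) \<in> adjoin G y z" "(b, e) \<in> adjoin G y z"
  then obtain p q p' q' where pq: "dual_poly G p q" "dual_poly G p' q'"
    and eqs: "a = poly p y" "d = poly q y + poly (formal_deriv p) y * z"
      "b = poly p' y" "e = poly q' y + poly (formal_deriv p') y * z"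
    unfolding adjoin_def by blast
  show "(a + b, d + e) \<in> adjoin G y z"
    unfolding adjoin_def
    by (rule CollectI, rule exI[of _ "p + p'"], rule exI[of _ "q + q'"])
      (use dual_poly_arith(1)[OF pq] in \<open>auto simp: eqs formal_deriv_linear algebra_simps\<close>)
  show "(a * b, a * e + d * b) \<in> adjoin G y z"
    unfolding adjoin_def
    by (rule CollectI, rule exI[of _ "p * p'"], rule exI[of _ "p * q' + q * p'"])
      (use dual_poly_arith(3)[OF pq] in \<open>auto simp: eqs formal_deriv_mult algebra_simps\<close>)
qed

text \<open>
  A value \<open>z\<close> at \<open>y\<close> is admissible modulo \<open>P\<close> if it respects all algebraic relations of \<open>y\<close>. When \<open>y\<close>
  satisfies no relation modulo \<open>P\<close>, every \<open>z\<close> is admissible. Otherwise take a relation \<open>p\<^sub>0\<close> of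
  least degree. Its derivative does not vanish at \<open>y\<close> modulo \<open>P\<close>, by minimality and characteristic
  \<open>0\<close>, so \<open>p\<^sub>0\<close> alone determines \<open>z\<close>. All other relations then respect \<open>z\<close> as well, because
  pseudo-division by \<open>p\<^sub>0\<close>, carried out over the dual numbers, lowers their degree.
\<close>

lemma adjoin_consistent_mod_prime:
  assumes reg: "von_neumann_regular TYPE('a)"
    and char0: "\<And>n. n > 0 \<Longrightarrow> (of_nat n :: 'a) dvd 1"
    and P: "prime_ideal P"
    and fun_P: "\<And>a d. (a, d) \<in> G \<Longrightarrow> a \<in> P \<Longrightarrow> d \<in> P"
  shows "\<exists>z. \<forall>p q. dual_poly G p q \<longrightarrow> poly p y \<in> P \<longrightarrow> poly q y + poly (formal_deriv p) y * z \<in> P"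
proof -
  note PD = prime_idealD[OF P]
  have trivial: "poly q y + poly (formal_deriv p) y * z \<in> P"
    if "dual_poly G p q" "\<And>i. coeff p i \<in> P" for p q z
    using that fun_P
    by (intro PD(3,4) prime_ideal_poly[OF P]) (auto simp: dual_poly_def coeff_formal_deriv intro!: PD(5))
  define bad where "bad n \<longleftrightarrow> (\<exists>p q. dual_poly G p q \<and> degree p = n \<and> poly p y \<in> P \<and> \<not> (\<forall>i. coeff p i \<in> P))" for n
  show ?thesis
  proof (cases "\<exists>n. bad n")
    case False
    then show ?thesis using trivial unfolding bad_def by blast
  next
    case True
    \<comment> \<open>the degree of a minimal polynomial of \<open>y\<close> over the domain of \<open>G\<close>, modulo \<open>P\<close>\<close>
    define n where "n = (LEAST n. bad n)"
    have "bad n" using True unfolding n_def by (auto intro: LeastI)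
    then obtain p0 q0 where p0: "dual_poly G p0 q0" "degree p0 = n" "poly p0 y \<in> P" "\<not> (\<forall>i. coeff p0 i \<in> P)"
      unfolding bad_def by blast
    have least: "coeff p i \<in> P" if "dual_poly G p q" "poly p y \<in> P" "degree p < n" for p q i
      using not_less_Least[of "degree p" bad] that unfolding n_def bad_def by blast
    have npos: "n > 0"
    proof (rule ccontr)
      assume "\<not> n > 0"
      then obtain c where "p0 = [:c:]" using p0(2) by (metis degree_eq_zeroE neq0_conv)
      then have "coeff p0 i \<in> P" for i
        using p0(3) PD(1) by (cases i) auto
      then show False using p0(4) by blast
    qed
    define c e where "c = coeff p0 n" and "e = coeff q0 n"
    have ce: "(c, e) \<in> G" using p0(1) by (simp add: c_def e_def dual_poly_def)
    \<comment> \<open>a leading coefficient in \<open>P\<close> could be dropped, contradicting minimality\<close>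
    have cP: "c \<notin> P"
    proof
      assume c: "c \<in> P"
      define p1 where "p1 = p0 - monom c n"
      have "degree p1 < n"
      proof (rule degree_lessI)
        show "p1 \<noteq> 0 \<or> 0 < n" using npos by simp
        show "\<forall>k\<ge>n. coeff p1 k = 0"
          using p0(2) by (auto simp: p1_def c_def coeff_eq_0)
      qed
      moreover have "dual_poly G p1 (q0 - monom e n)"
        unfolding p1_def by (intro dual_poly_arith(2) p0(1) dual_poly_monom ce)
      moreover have "poly p1 y \<in> P"
        unfolding p1_def poly_diff poly_monom by (intro PD(8) PD(4) p0(3) c)
      ultimately have "coeff p1 i \<in> P" for i by (metis least)
      then have "coeff p0 i \<in> P" for i
        using PD(3)[of "coeff p1 i" "coeff (monom c n) i"] c PD(1)
        by (simp add: p1_def split: if_splits)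
      then show False using p0(4) by blast
    qed
    \<comment> \<open>separability: otherwise \<open>p0'\<close> would be a relation of smaller degree with leading coefficient \<open>n c\<close>\<close>
    have "poly (formal_deriv p0) y \<notin> P"
    proof
      assume "poly (formal_deriv p0) y \<in> P"
      moreover have "degree (formal_deriv p0) < n"
        by (rule degree_lessI) (use npos p0(2) in \<open>auto simp: coeff_formal_deriv coeff_eq_0\<close>)
      ultimately have "coeff (formal_deriv p0) (n - 1) \<in> P"
        using least[OF dual_poly_formal_deriv[OF p0(1)]] by blast
      then have nc: "of_nat n * c \<in> P" using npos by (simp add: coeff_formal_deriv c_def)
      obtain r where r: "1 = of_nat n * (r::'a)" using char0[OF npos] unfolding dvd_def by blast
      have "r * (of_nat n * c) = of_nat n * r * c" by (simp add: algebra_simps)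
      then have "c = r * (of_nat n * c)" using r by simp
      then show False using cP PD(5)[OF nc, of r] by simp
    qed
    then obtain w where w: "1 - poly (formal_deriv p0) y * w \<in> P"
      using prime_ideal_inverse[OF reg P] by blast
    define z where "z = - (w * poly q0 y)"
    \<comment> \<open>the \<open>\<epsilon>\<close>-part of \<open>p + q \<epsilon>\<close> at \<open>y + z \<epsilon>\<close>; it obeys the Leibniz rule used below\<close>
    define E where "E p q = poly q y + poly (formal_deriv p) y * z" for p q
    have E0: "E p0 q0 \<in> P"
      using PD(4)[OF w, of "poly q0 y"] by (simp add: E_def z_def algebra_simps)
    have "E p q \<in> P" if "dual_poly G p q" "poly p y \<in> P" for p q
      using that
    proof (induction "degree p" arbitrary: p q rule: less_induct)
      case less
      show ?case
      proof (cases "degree p < n")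
        case True
        then show ?thesis unfolding E_def using trivial least less.prems by blast
      next
        case False
        define m a d where "m = degree p" and "a = coeff p m" and "d = coeff q m"
        have mn: "n \<le> m" "0 < m" using False npos by (auto simp: m_def)
        have ad: "(a, d) \<in> G" using less.prems(1) by (simp add: a_def d_def dual_poly_def)
        \<comment> \<open>one step of pseudo-division, \<open>(c + e \<epsilon>) (p + q \<epsilon>) - (a + d \<epsilon>) X^(m - n) (p0 + q0 \<epsilon>)\<close>\<close>
        define p1 where "p1 = monom c 0 * p - monom a (m - n) * p0"
        define q1 where "q1 = (monom c 0 * q + monom e 0 * p) - (monom a (m - n) * q0 + monom d (m - n) * p0)"
        have G1: "dual_poly G p1 q1"
          unfolding p1_def q1_def
          by (intro dual_poly_arith dual_poly_monom ce ad p0(1) less.prems(1))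
        have "degree p1 < m"
        proof (rule degree_lessI)
          show "p1 \<noteq> 0 \<or> 0 < m" using mn by simp
          show "\<forall>k\<ge>m. coeff p1 k = 0"
          proof (intro allI impI)
            fix k assume k: "m \<le> k"
            show "coeff p1 k = 0"
            proof (cases "k = m")
              case True
              then have "coeff p1 k = c * a - a * c" using mn
                by (simp add: p1_def coeff_monom_mult a_def c_def)
              then show ?thesis by simp
            next
              case False
              then have "coeff p k = 0" "coeff p0 (k - (m - n)) = 0"
                using k mn p0(2) by (auto simp: m_def intro!: coeff_eq_0)
              then show ?thesis by (simp add: p1_def coeff_monom_mult)
            qed
          qed
        qed
        moreover have "poly p1 y \<in> P"
          unfolding p1_def poly_diff poly_mult by (intro PD(8) PD(5) p0(3) less.prems(2))
        ultimately have IH: "E p1 q1 \<in> P" using less.hyps G1 unfolding m_def by blast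
        have "E p1 q1 = c * E p q + e * poly p y - (poly (monom a (m - n)) y * E p0 q0
            + (poly (formal_deriv (monom a (m - n))) y * z + poly (monom d (m - n)) y) * poly p0 y)"
          unfolding E_def p1_def q1_def
          by (simp add: formal_deriv_linear formal_deriv_mult monom_0 algebra_simps)
        then have "c * E p q = E p1 q1 - e * poly p y + (poly (monom a (m - n)) y * E p0 q0
            + (poly (formal_deriv (monom a (m - n))) y * z + poly (monom d (m - n)) y) * poly p0 y)"
          by simp
        also have "\<dots> \<in> P"
          by (intro PD(3) PD(8) IH PD(5) E0 p0(3) less.prems)
        finally show ?thesis using PD(6) cP by blast
      qed
    qed
    then show ?thesis unfolding E_def by blast
  qed
qed

end

section \<open>Supports and convergence\<close>

locale complete_regular_algebra = complex_algebra cscale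
  for cscale :: "complex \<Rightarrow> 'a::comm_ring_1 \<Rightarrow> 'a" +
  fixes \<mu> :: "'a \<Rightarrow> real"
  assumes reg: "von_neumann_regular TYPE('a)"
    and meas: "finite_measure_on_idempotents \<mu>"
    and pos: "strictly_positive \<mu>"
    and complete: "Metric_space.mcomplete UNIV (rho \<mu>)"
begin

lemma supp_idem: "supp (a::'a) * supp a = supp a"
  and supp_mult: "supp a * a = a"
  and supp_least: "f * f = f \<Longrightarrow> f * a = a \<Longrightarrow> supp a * f = supp a"
  using is_support_supp[OF reg, of a] by (auto simp: is_support_def idempotents_iff idem_le_def)

text \<open>
  An element and its support generate the same ideal.
\<close>

lemma supp_dvd: "(a::'a) dvd supp a"
proof -
  obtain b where b: "a = a * b * a"
    using reg unfolding von_neumann_regular_def by blast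
  then have "supp a * (a * b) = supp a"
    by (intro supp_least) (metis mult.assoc)+
  then have "supp a = a * b" by (simp add: mult.assoc[symmetric] supp_mult)
  then show ?thesis by simp
qed

lemma supp_idempotent: "e * e = e \<Longrightarrow> supp (e::'a) = e"
  using supp_least[of e e] supp_mult[of e] by simp

text \<open>
  The distance \<open>\<rho>(a, 0)\<close>. It is subadditive and depends only on the support, but it is not homogeneous.
\<close>

definition nrm :: "'a \<Rightarrow> real" where
  "nrm a = \<mu> (supp a)"

lemma rho_eq_nrm: "rho \<mu> a b = nrm (a - b)"
  by (simp add: rho_def nrm_def)

lemma mu_nonneg: "e * e = e \<Longrightarrow> 0 \<le> \<mu> e"
  using meas by (auto simp: finite_measure_on_idempotents_def idempotents_iff)

lemma mu_mono: "e * e = e \<Longrightarrow> f * f = f \<Longrightarrow> e * f = e \<Longrightarrow> \<mu> e \<le> \<mu> f"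
  using finite_measure_on_idempotents_mono[OF meas] by (simp add: idempotents_iff idem_le_def)

lemma mu_add: "e * e = e \<Longrightarrow> f * f = f \<Longrightarrow> e * f = 0 \<Longrightarrow> \<mu> (e + f) = \<mu> e + \<mu> f"
  using finite_measure_on_idempotents_add[OF meas] by (simp add: idempotents_iff)

lemma nrm_nonneg: "0 \<le> nrm a"
  by (simp add: nrm_def mu_nonneg supp_idem)

lemma nrm_idempotent: "e * e = e \<Longrightarrow> nrm e = \<mu> e"
  by (simp add: nrm_def supp_idempotent)

lemma nrm_le: "e * e = e \<Longrightarrow> e * d = d \<Longrightarrow> nrm d \<le> \<mu> e"
  unfolding nrm_def by (intro mu_mono supp_idem supp_least)

lemma nrm_le_nrm: "supp a * d = d \<Longrightarrow> nrm d \<le> nrm a"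
  unfolding nrm_def[of a] by (intro nrm_le supp_idem)

lemma nrm_mult: "nrm (b * a) \<le> nrm a"
  by (rule nrm_le_nrm) (metis supp_mult mult.left_commute)

lemma nrm_eq_0: "nrm a = 0 \<Longrightarrow> a = 0"
  using Metric_space.zero[OF Metric_space_rho[OF reg meas pos], of a 0] by (simp add: rho_eq_nrm)

lemma nrm_minus: "nrm (- a) = nrm a"
  using Metric_space.commute[OF Metric_space_rho[OF reg meas pos], of a 0] by (simp add: rho_eq_nrm)

lemma nrm_triangle: "nrm (a + b) \<le> nrm a + nrm b"
  using Metric_space.triangle[OF Metric_space_rho[OF reg meas pos], of a 0 "- b"]
  by (simp add: rho_eq_nrm)

lemma nrm_triangle_diff: "nrm (a - b) \<le> nrm a + nrm b"
  using nrm_triangle[of a "- b"] by (simp add: nrm_minus)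

lemma mu_sum_disjoint:
  assumes "finite I" "\<And>i. i \<in> I \<Longrightarrow> e i * e i = e i" "\<And>i j. i \<in> I \<Longrightarrow> j \<in> I \<Longrightarrow> i \<noteq> j \<Longrightarrow> e i * e j = 0"
  shows "sum e I * sum e I = sum e I \<and> \<mu> (sum e I) = (\<Sum>i\<in>I. \<mu> (e i))"
  using assms
proof (induction I rule: finite_induct)
  case empty
  then show ?case by (simp add: finite_measure_on_idempotents_zero[OF meas])
next
  case (insert i I)
  have IH: "sum e I * sum e I = sum e I \<and> \<mu> (sum e I) = (\<Sum>i\<in>I. \<mu> (e i))"
    using insert by simp
  have "e i * e j = 0" if "j \<in> I" for j
    using insert that by (metis insertCI)
  then have d: "e i * sum e I = 0" by (simp add: sum_distrib_left)
  have ei: "e i * e i = e i" using insert by simp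
  have "\<mu> (e i + sum e I) = \<mu> (e i) + \<mu> (sum e I)"
    using mu_add ei IH d by blast
  then show ?case
    using insert.hyps IH ei d by (simp add: algebra_simps)
qed

definition tends :: "(nat \<Rightarrow> 'a) \<Rightarrow> 'a \<Rightarrow> bool" where
  "tends x l \<longleftrightarrow> (\<lambda>n. nrm (x n - l)) \<longlonglongrightarrow> 0"

lemma limitin_iff_tends:
  "limitin (Metric_space.mtopology UNIV (rho \<mu>)) x l sequentially \<longleftrightarrow> tends x l"
  unfolding Metric_space.limit_metric_sequentially[OF Metric_space_rho[OF reg meas pos]]
  by (simp add: tends_def LIMSEQ_def rho_eq_nrm nrm_nonneg)

lemma tends_Cauchy:
  assumes "\<And>m n. nrm (x m - x n) \<le> \<beta> m + \<beta> n" and "\<beta> \<longlonglongrightarrow> 0"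
  shows "\<exists>l. tends x l"
proof -
  note M = Metric_space_rho[OF reg meas pos]
  have "Metric_space.MCauchy UNIV (rho \<mu>) x"
    unfolding Metric_space.MCauchy_def[OF M]
  proof (intro conjI allI impI)
    fix \<epsilon> :: real assume "\<epsilon> > 0"
    then obtain N where N: "\<And>n. n \<ge> N \<Longrightarrow> \<beta> n < \<epsilon> / 2"
      using order_tendstoD(2)[OF assms(2), of "\<epsilon> / 2"] by (auto simp: eventually_sequentially)
    show "\<exists>N. \<forall>n n'. N \<le> n \<longrightarrow> N \<le> n' \<longrightarrow> rho \<mu> (x n) (x n') < \<epsilon>"
    proof (intro exI[of _ N] allI impI)
      fix n n' assume "N \<le> n" "N \<le> n'"
      then show "rho \<mu> (x n) (x n') < \<epsilon>"
        using N[of n] N[of n'] assms(1)[of n n'] by (simp add: rho_eq_nrm)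
    qed
  qed simp
  then show ?thesis
    using complete limitin_iff_tends unfolding Metric_space.mcomplete_def[OF M] by blast
qed

lemma tends_contraction:
  assumes "tends x l" "\<And>n. nrm (y n - k) \<le> nrm (x n - l)"
  shows "tends y k"
  unfolding tends_def
  by (rule tendsto_sandwich[OF _ _ tendsto_const assms(1)[unfolded tends_def]])
    (simp_all add: nrm_nonneg assms(2))

lemma tends_mult: "tends x l \<Longrightarrow> tends (\<lambda>n. b * x n) (b * l)"
  by (erule tends_contraction) (simp add: nrm_mult flip: right_diff_distrib)

lemma tends_unique:
  assumes "tends x l" "tends y k" "eventually (\<lambda>n. x n = y n) sequentially"
  shows "l = k"
proof -
  have "(\<lambda>n. nrm (y n - k) + nrm (x n - l)) \<longlonglongrightarrow> 0 + 0"
    using assms(1,2) unfolding tends_def by (intro tendsto_add)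
  moreover have "eventually (\<lambda>n. nrm (l - k) \<le> nrm (y n - k) + nrm (x n - l)) sequentially"
    using assms(3)
  proof eventually_elim
    case (elim n)
    then show ?case using nrm_triangle_diff[of "y n - k" "x n - l"] by simp
  qed
  ultimately have "nrm (l - k) \<le> 0"
    using tendsto_lowerbound[of _ "0 + 0" sequentially "nrm (l - k)"] by simp
  then show ?thesis using nrm_eq_0[of "l - k"] nrm_nonneg[of "l - k"] by simp
qed


section \<open>Linear systems are solvable as soon as they are solvable modulo every prime\<close>

text \<open>
  The local hypothesis lets the set \<open>S\<close> of pairs \<open>(u, v)\<close>, the equations \<open>u z = v\<close>, be enlarged to
  the submodule \<open>L\<close> of all equations that follow from \<open>S\<close> modulo every prime. It is the graph of a
  module homomorphism: \<open>(0, v) \<in> L\<close> forces \<open>v\<close> into every prime ideal. The task is to show that this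
  homomorphism, defined on an ideal \<open>I\<close>, is multiplication by some \<open>z\<close>. If \<open>I\<close> contained a largest
  idempotent, its image would serve as \<open>z\<close>. In general, take idempotents \<open>w\<^sub>n \<in> I\<close> whose measures
  approach the supremum over \<open>I\<close>. Homomorphisms do not increase supports, so the images of the
  \<open>w\<^sub>n\<close> form a Cauchy sequence, and its limit is \<open>z\<close>.
\<close>

lemma linear_system_local_global:
  assumes loc: "\<And>P. prime_ideal P \<Longrightarrow> \<exists>z. \<forall>(u, v)\<in>S. v - u * z \<in> P"
  shows "\<exists>z. \<forall>(u, v)\<in>S. v = u * (z::'a)"
proof -
  define L where "L = {(u, v). \<forall>P z. prime_ideal P \<longrightarrow> (\<forall>(u', v')\<in>S. v' - u' * z \<in> P) \<longrightarrow> v - u * z \<in> P}"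
  have SL: "S \<subseteq> L" by (auto simp: L_def)
  have Lfun: "v = 0" if "(0, v) \<in> L" for v
  proof (rule ccontr)
    assume "v \<noteq> 0"
    then obtain P where P: "prime_ideal P" "v \<notin> P"
      using prime_ideal_avoiding[OF reg] by blast
    then show False using loc[OF P(1)] that unfolding L_def by auto
  qed
  have Lscale: "(c * u, c * v) \<in> L" if "(u, v) \<in> L" for c u v
  proof -
    have "c * v - c * u * z \<in> P" if "prime_ideal P" "v - u * z \<in> P" for P z
      using prime_idealD(5)[OF that, of c] by (simp add: algebra_simps)
    then show ?thesis using that unfolding L_def by blast
  qed
  have Ladd: "(u + u', v + v') \<in> L" if "(u, v) \<in> L" "(u', v') \<in> L" for u v u' v'
  proof -
    have "v + v' - (u + u') * z \<in> P" if "prime_ideal P" "v - u * z \<in> P" "v' - u' * z \<in> P" for P z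
      using prime_idealD(3)[OF that] by (simp add: algebra_simps)
    then show ?thesis using that unfolding L_def by blast
  qed
  have Ldiff: "(u - u', v - v') \<in> L" if "(u, v) \<in> L" "(u', v') \<in> L" for u v u' v'
    using Ladd[OF that(1) Lscale[OF that(2), of "- 1"]] by simp
  have Lsupp: "supp u * v = v" if "(u, v) \<in> L" for u v
    using Lfun[of "v - supp u * v"] Ldiff[OF that Lscale[OF that, of "supp u"]]
    by (simp add: supp_mult)

  define E where "E = {(e, v) \<in> L. e * e = e}"
  have zeroE: "(0, 0) \<in> E" using prime_idealD(1) by (auto simp: E_def L_def)
  define \<sigma> where "\<sigma> = (SUP p\<in>E. \<mu> (fst p))"
  have bdd: "bdd_above ((\<lambda>p. \<mu> (fst p)) ` E)"
    by (rule bdd_aboveI2[of _ _ "\<mu> 1"]) (auto simp: E_def intro!: mu_mono)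
  have upper: "\<mu> e \<le> \<sigma>" if "(e, v) \<in> E" for e v
    unfolding \<sigma>_def using cSUP_upper[OF that bdd] by simp
  have "\<exists>p\<in>E. \<sigma> - 1 / real (Suc n) < \<mu> (fst p)" for n
    using less_cSUP_iff[OF _ bdd, of "\<sigma> - 1 / real (Suc n)"] zeroE unfolding \<sigma>_def by fastforce
  then obtain W where W: "\<And>n. W n \<in> E" "\<And>n. \<sigma> - 1 / real (Suc n) < \<mu> (fst (W n))"
    by metis
  define w where "w n = fst (W n)" for n
  define \<phi> where "\<phi> n = snd (W n)" for n
  have wL: "(w n, \<phi> n) \<in> L" and ww: "w n * w n = w n" and wE: "(w n, \<phi> n) \<in> E" for n
    using W(1)[of n] by (auto simp: w_def \<phi>_def E_def)
  define \<beta> where "\<beta> n = \<sigma> - \<mu> (w n)" for n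
  have \<beta>: "\<beta> \<longlonglongrightarrow> 0"
  proof (rule tendsto_sandwich[OF _ _ tendsto_const LIMSEQ_inverse_real_of_nat])
    show "\<forall>\<^sub>F n in sequentially. 0 \<le> \<beta> n"
      using upper[OF wE] by (simp add: \<beta>_def)
    show "\<forall>\<^sub>F n in sequentially. \<beta> n \<le> inverse (real (Suc n))"
      using W(2) by (auto simp: \<beta>_def w_def field_simps intro!: always_eventually less_imp_le)
  qed
  have remainder_idem: "(e - w n * e) * (e - w n * e) = e - w n * e" if "(e, v) \<in> E" for e v n
  proof -
    have "(e - w n * e) * (e - w n * e) = (1 - w n) * (1 - w n) * (e * e)"
      by (simp only: algebra_simps) simp
    also have "(1 - w n) * (1 - w n) = 1 - w n" by (simp add: algebra_simps ww)
    finally show ?thesis using that by (simp add: E_def left_diff_distrib)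
  qed
  \<comment> \<open>almost all of an idempotent of the ideal lies under \<open>w n\<close>, since the join \<open>w n + (e - w n * e)\<close> is in the ideal too\<close>
  have remainder: "\<mu> (e - w n * e) \<le> \<beta> n" if e: "(e, v) \<in> E" for e v n
  proof -
    have ee: "e * e = e" using e by (simp add: E_def)
    have wee: "w n * (w n * x) = w n * x" for x
      using ww[of n] by (simp flip: mult.assoc)
    have d: "(e - w n * e) * (e - w n * e) = e - w n * e" "w n * (e - w n * e) = 0"
      using remainder_idem[OF e] by (simp_all add: wee right_diff_distrib)
    have we: "(w n + (e - w n * e), \<phi> n + (v - w n * v)) \<in> L"
      using e by (intro Ladd Ldiff wL Lscale) (auto simp: E_def)
    have "(w n + (e - w n * e)) * (w n + (e - w n * e)) = w n + (e - w n * e)"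
      by (simp only: distrib_left distrib_right ww d mult.commute[of "e - w n * e" "w n"]) simp
    then have "(w n + (e - w n * e), \<phi> n + (v - w n * v)) \<in> E"
      using we by (simp add: E_def)
    from upper[OF this] have "\<mu> (w n + (e - w n * e)) \<le> \<sigma>" .
    then show ?thesis using mu_add[OF ww[of n] d] by (simp add: \<beta>_def)
  qed
  have "nrm (\<phi> m - \<phi> n) \<le> \<beta> m + \<beta> n" for m n
  proof -
    have "nrm (\<phi> m - \<phi> n) \<le> nrm (w m - w n)"
      using Lsupp[OF Ldiff[OF wL wL]] by (rule nrm_le_nrm)
    also have "\<dots> \<le> nrm (w m - w n * w m) + nrm (w n - w m * w n)"
      using nrm_triangle_diff[of "w m - w n * w m" "w n - w m * w n"] by (simp add: algebra_simps)
    also have "\<dots> \<le> \<beta> n + \<beta> m"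
      unfolding nrm_idempotent[OF remainder_idem[OF wE]] using remainder[OF wE] by (intro add_mono)
    finally show ?thesis by simp
  qed
  then obtain z where z: "tends \<phi> z" using tends_Cauchy[OF _ \<beta>] by blast
  have "v = u * z" if uv: "(u, v) \<in> L" for u v
  proof -
    obtain r where "supp u = r * u" using supp_dvd[of u] unfolding dvd_def by (metis mult.commute)
    then have E: "(supp u, r * v) \<in> E"
      using Lscale[OF uv, of r] supp_idem[of u] by (simp add: E_def)
    \<comment> \<open>both sides are the image of \<open>w n * u\<close>\<close>
    have eq: "w n * v = u * \<phi> n" for n
      using Lfun[of "w n * v - u * \<phi> n"] Ldiff[OF Lscale[OF uv, of "w n"] Lscale[OF wL, of u n]]
      by (simp add: mult.commute)
    have "tends (\<lambda>n. w n * v) v"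
      unfolding tends_def
    proof (rule tendsto_sandwich[OF _ _ tendsto_const \<beta>])
      have "nrm (w n * v - v) \<le> \<beta> n" for n
      proof -
        have "(supp u - w n * supp u) * (supp u - w n * supp u) = supp u - w n * supp u"
          using remainder_idem[OF E] .
        moreover have "(supp u - w n * supp u) * (w n * v - v) = w n * v - v"
        proof -
          have sv: "supp u * v = v" by (rule Lsupp[OF uv])
          have "(supp u - w n * supp u) * (w n * v - v) = (1 - w n) * (w n - 1) * (supp u * v)"
            by (simp add: algebra_simps)
          also have "(1 - w n) * (w n - 1) = w n - 1" by (simp add: algebra_simps ww)
          finally show ?thesis by (simp only: sv left_diff_distrib mult_1)
        qed
        ultimately have "nrm (w n * v - v) \<le> \<mu> (supp u - w n * supp u)"
          by (rule nrm_le)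
        then show ?thesis using remainder[OF E, of n] by simp
      qed
      then show "\<forall>\<^sub>F n in sequentially. nrm (w n * v - v) \<le> \<beta> n" by simp
    qed (simp add: nrm_nonneg)
    then show ?thesis
      using tends_unique tends_mult[OF z, of u] by (auto simp: eq)
  qed
  then show ?thesis using SL by blast
qed

section \<open>Extending a partial derivation to the whole algebra\<close>

abbreviation const :: "complex \<Rightarrow> 'a" where
  "const \<alpha> \<equiv> cscale \<alpha> 1"

lemma cscale_eq: "cscale \<alpha> x = const \<alpha> * x"
  by (simp add: scale_mult_left)

lemma const_hom:
  "const (\<alpha> + \<beta>) = const \<alpha> + const \<beta>" "const (\<alpha> - \<beta>) = const \<alpha> - const \<beta>"
  "const (\<alpha> * \<beta>) = const \<alpha> * const \<beta>" "const 0 = 0" "const 1 = 1"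
  by (simp_all add: scale_left_distrib scale_left_diff_distrib scale_mult_left)

lemma of_nat_eq_const: "of_nat n = const (of_nat n)"
  by (induction n) (simp_all add: const_hom)

lemma const_dvd_1: "\<alpha> \<noteq> 0 \<Longrightarrow> const \<alpha> dvd 1"
  using const_hom(3)[of \<alpha> "inverse \<alpha>"] by (simp add: const_hom(5) dvd_def) metis

lemma const_notin_prime_ideal: "prime_ideal P \<Longrightarrow> \<alpha> \<noteq> 0 \<Longrightarrow> const \<alpha> \<notin> P"
  using const_dvd_1[of \<alpha>] prime_idealD(2,4) unfolding dvd_def by metis

text \<open>
  The elements whose residue at each prime ideal is a complex number; by compactness of the prime
  spectrum they are the finite linear combinations of idempotents. The description by residues makes
  it immediate that they form a subalgebra.
\<close>

definition constants :: "'a set" where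
  "constants = {u. \<forall>P. prime_ideal P \<longrightarrow> (\<exists>\<alpha>. u - const \<alpha> \<in> P)}"

lemma const_in_constants: "const \<alpha> \<in> constants"
  unfolding constants_def using prime_idealD(1) by (auto intro!: exI[of _ \<alpha>])

lemma idempotent_in_constants:
  assumes "e * e = e"
  shows "e \<in> constants"
  unfolding constants_def
proof (intro CollectI allI impI)
  fix P :: "'a set" assume P: "prime_ideal P"
  have "e * (e - 1) \<in> P" using assms prime_idealD(1)[OF P] by (simp add: algebra_simps)
  then have "e - const 0 \<in> P \<or> e - const 1 \<in> P"
    using prime_idealD(6)[OF P] by (auto simp: const_hom)
  then show "\<exists>\<alpha>. e - const \<alpha> \<in> P" by blast
qed

lemma dual_subring_constants: "dual_subring (constants \<times> {0})"
  unfolding dual_subring_def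
proof (intro conjI allI impI)
  show "(1, 0) \<in> constants \<times> {0}" "(- 1, 0) \<in> constants \<times> {0}"
    using const_in_constants[of 1] const_in_constants[of "- 1"] const_hom(2)[of 0 1]
    by (auto simp: const_hom)
  fix a d b e assume "(a, d) \<in> constants \<times> {0::'a}" "(b, e) \<in> constants \<times> {0::'a}"
  then have ab: "a \<in> constants" "b \<in> constants" and [simp]: "d = 0" "e = 0" by auto
  have "a + b \<in> constants \<and> a * b \<in> constants"
    unfolding constants_def
  proof (intro conjI CollectI allI impI)
    fix P :: "'a set" assume P: "prime_ideal P"
    then obtain \<alpha> \<beta> where \<alpha>\<beta>: "a - const \<alpha> \<in> P" "b - const \<beta> \<in> P"
      using ab unfolding constants_def by blast
    show "\<exists>\<gamma>. a + b - const \<gamma> \<in> P"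
      using prime_idealD(3)[OF P \<alpha>\<beta>] by (intro exI[of _ "\<alpha> + \<beta>"]) (simp add: const_hom algebra_simps)
    have "(a - const \<alpha>) * b + const \<alpha> * (b - const \<beta>) \<in> P"
      by (intro prime_idealD(3,4,5)[OF P] \<alpha>\<beta>)
    then show "\<exists>\<gamma>. a * b - const \<gamma> \<in> P"
      by (intro exI[of _ "\<alpha> * \<beta>"]) (simp add: const_hom(3) right_diff_distrib left_diff_distrib)
  qed
  then show "(a + b, d + e) \<in> constants \<times> {0}" "(a * b, a * e + d * b) \<in> constants \<times> {0}"
    by auto
qed

text \<open>
  Graphs of derivations on subalgebras that contain all constants and kill them. Having the
  idempotents among the constants keeps the derivation from increasing supports, so that it
  is compatible with reduction modulo prime ideals.
\<close>

definition partial_derivation :: "('a \<times> 'a) set \<Rightarrow> bool" where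
  "partial_derivation G \<longleftrightarrow> dual_subring G \<and> (\<forall>d. (0, d) \<in> G \<longrightarrow> d = 0) \<and> constants \<times> {0} \<subseteq> G"

lemma partial_derivation_mod_prime:
  assumes G: "partial_derivation G" and P: "prime_ideal P" and ad: "(a, d) \<in> G" "a \<in> P"
  shows "d \<in> P"
proof -
  have "(1 - supp a) * (1 - supp a) = 1 - supp a"
    by (simp add: algebra_simps supp_idem)
  then have "(1 - supp a, 0) \<in> G"
    using G idempotent_in_constants by (auto simp: partial_derivation_def)
  then have "((1 - supp a) * a, (1 - supp a) * d + 0 * a) \<in> G"
    using dual_subringD(4) G ad(1) unfolding partial_derivation_def by blast
  then have "(0, (1 - supp a) * d) \<in> G" by (simp add: left_diff_distrib supp_mult)
  then have "(1 - supp a) * d = 0" using G unfolding partial_derivation_def by blast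
  then have d: "d = supp a * d" by (simp add: algebra_simps)
  have "supp a \<in> P" using supp_dvd[of a] ad(2) prime_idealD(4)[OF P] by (auto elim: dvdE)
  then show ?thesis using d prime_idealD(4)[OF P] by metis
qed

text \<open>
  The value \<open>z\<close> at \<open>y\<close> has to solve \<open>p'(y) z = - q(y)\<close> for all \<open>p + q \<epsilon>\<close> with \<open>p(y) = 0\<close>. By the
  local-global principle it suffices to solve this system modulo each prime.
\<close>

lemma partial_derivation_adjoin:
  assumes G: "partial_derivation G"
  shows "\<exists>z. partial_derivation (adjoin G y z)"
proof -
  have Gr: "dual_subring G" using G by (simp add: partial_derivation_def)
  define S where "S = {(poly (formal_deriv p) y, - poly q y) | p q. dual_poly G p q \<and> poly p y = 0}"
  have "\<exists>z. \<forall>(u, v)\<in>S. v - u * z \<in> P" if P: "prime_ideal P" for P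
  proof -
    have char0: "of_nat n dvd (1::'a)" if "n > 0" for n
      unfolding of_nat_eq_const by (rule const_dvd_1) (use that in simp)
    obtain z where z: "\<And>p q. dual_poly G p q \<Longrightarrow> poly p y \<in> P \<Longrightarrow>
        poly q y + poly (formal_deriv p) y * z \<in> P"
      using adjoin_consistent_mod_prime[OF Gr reg char0 P, of y] partial_derivation_mod_prime[OF G P]
      by blast
    have "v - u * z \<in> P" if "(u, v) \<in> S" for u v
    proof -
      obtain p q where "dual_poly G p q" "poly p y = 0" "u = poly (formal_deriv p) y" "v = - poly q y"
        using \<open>(u, v) \<in> S\<close> unfolding S_def by blast
      then show ?thesis
        using prime_idealD(7)[OF P z[of p q]] prime_idealD(1)[OF P] by simp
    qed
    then show ?thesis by blast
  qed
  then obtain z where z: "\<forall>(u, v)\<in>S. v = u * z"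
    using linear_system_local_global[of S] by blast
  have "d = 0" if "(0, d) \<in> adjoin G y z" for d
  proof -
    obtain p q where pq: "dual_poly G p q" "0 = poly p y" "d = poly q y + poly (formal_deriv p) y * z"
      using \<open>(0, d) \<in> adjoin G y z\<close> unfolding adjoin_def by blast
    then have "(poly (formal_deriv p) y, - poly q y) \<in> S" unfolding S_def by auto
    then have "- poly q y = poly (formal_deriv p) y * z" using z by blast
    then show ?thesis using pq(3) by (metis add.right_inverse)
  qed
  moreover have "constants \<times> {0} \<subseteq> adjoin G y z"
    using G adjoin_contains(1)[OF Gr, of y z] unfolding partial_derivation_def by blast
  ultimately show ?thesis
    using dual_subring_adjoin[OF Gr] unfolding partial_derivation_def by blast
qed

text \<open>
  The complex numbers are algebraically closed, so an element of the residue field at \<open>P\<close> outside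
  of them is transcendental.
\<close>

lemma nonzero_complex_poly_notin_prime_ideal:
  assumes P: "prime_ideal P" and x: "\<And>\<alpha>. x - const \<alpha> \<notin> P" and "f \<noteq> 0"
  shows "poly (map_poly const f) x \<notin> P"
  using \<open>f \<noteq> 0\<close>
proof (induction "degree f" arbitrary: f rule: less_induct)
  case less
  show ?case
  proof (cases "degree f = 0")
    case True
    then obtain a where "f = [:a:]" by (auto elim: degree_eq_zeroE)
    then show ?thesis
      using const_notin_prime_ideal[OF P] less.prems by (auto simp: map_poly_pCons const_hom)
  next
    case False
    then obtain \<alpha> where "poly f \<alpha> = 0"
      using fundamental_theorem_of_algebra[of f] by (auto simp: constant_degree)
    then obtain g where g: "f = [:- \<alpha>, 1:] * g" by (auto simp: poly_eq_0_iff_dvd elim: dvdE)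
    then have "g \<noteq> 0" using less.prems by auto
    then have "degree g < degree f" using g degree_mult_eq[of "[:- \<alpha>, 1:]" g] by simp
    then have IH: "poly (map_poly const g) x \<notin> P" using less.hyps \<open>g \<noteq> 0\<close> by blast
    have "f = pCons 0 g - smult \<alpha> g" by (simp add: g)
    then have "map_poly const f = pCons 0 (map_poly const g) - smult (const \<alpha>) (map_poly const g)"
      by (intro poly_eqI)
        (simp add: coeff_map_poly const_hom coeff_pCons split: nat.splits)
    then have "poly (map_poly const f) x = (x - const \<alpha>) * poly (map_poly const g) x"
      by (simp add: left_diff_distrib)
    then show ?thesis using IH x prime_idealD(6)[OF P] by metis
  qed
qed

text \<open>
  Under this condition the residue of \<open>x\<close> at a prime ideal not containing the idempotent \<open>t\<close> is never
  a complex number.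
\<close>

definition nowhere_constant_on :: "'a \<Rightarrow> 'a \<Rightarrow> bool" where
  "nowhere_constant_on x t \<longleftrightarrow> (\<forall>\<alpha> f. f * f = f \<longrightarrow> f * t = f \<longrightarrow> f * x = cscale \<alpha> f \<longrightarrow> f = 0)"

text \<open>
  The assignment \<open>x \<mapsto> t\<close> respects the relations of \<open>x\<close> over the constants. At a prime containing \<open>t\<close>
  the derivation is zero, and at any other prime \<open>x\<close> is transcendental over the complex numbers, so
  that all relations of \<open>x\<close> are trivial there.
\<close>

lemma partial_derivation_initial:
  assumes t: "t * t = t" and nc: "nowhere_constant_on x t"
  shows "partial_derivation (adjoin (constants \<times> {0}) x t)"
proof -
  let ?G = "constants \<times> {0::'a}"
  have "d = 0" if d: "(0, d) \<in> adjoin ?G x t" for d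
  proof (rule ccontr)
    assume "d \<noteq> 0"
    then obtain P where P: "prime_ideal P" "d \<notin> P"
      using prime_ideal_avoiding[OF reg] by blast
    note PD = prime_idealD[OF P(1)]
    obtain p q where pq: "dual_poly ?G p q" "0 = poly p x" "d = poly q x + poly (formal_deriv p) x * t"
      using d unfolding adjoin_def by blast
    have "q = 0" using pq(1) by (auto intro: poly_eqI simp: dual_poly_def)
    then have d: "d = poly (formal_deriv p) x * t" using pq(3) by simp
    have xP: "x - const \<alpha> \<notin> P" for \<alpha>
    proof
      assume u: "x - const \<alpha> \<in> P"
      \<comment> \<open>the largest idempotent below \<open>t\<close> on which \<open>x\<close> equals \<open>\<alpha>\<close>\<close>
      define f where "f = t * (1 - supp (x - const \<alpha>))"
      have "(1 - supp (x - const \<alpha>)) * (1 - supp (x - const \<alpha>)) = 1 - supp (x - const \<alpha>)"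
        by (simp add: algebra_simps supp_idem)
      then have "f * f = f" "f * t = f"
        using t unfolding f_def by (metis mult.assoc mult.commute)+
      moreover have "f * (x - const \<alpha>) = 0"
        unfolding f_def by (simp add: mult.assoc left_diff_distrib supp_mult)
      then have "f * x = cscale \<alpha> f" by (simp add: right_diff_distrib cscale_eq[of \<alpha> f] mult.commute)
      ultimately have "f = 0" using nc unfolding nowhere_constant_on_def by blast
      then have "t = t * supp (x - const \<alpha>)" by (simp add: f_def right_diff_distrib)
      moreover have "supp (x - const \<alpha>) \<in> P"
        using supp_dvd[of "x - const \<alpha>"] u PD(4) by (auto elim: dvdE)
      ultimately have "t \<in> P" using PD(5) by metis
      then show False using d P(2) PD(5) by blast
    qed
    have "\<exists>\<alpha>. coeff p i - const \<alpha> \<in> P" for i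
      using pq(1) P(1) unfolding dual_poly_def constants_def by blast
    then obtain \<alpha> where \<alpha>: "\<And>i. coeff p i - const (\<alpha> i) \<in> P" by metis
    \<comment> \<open>the reduction of \<open>p\<close> modulo \<open>P\<close>\<close>
    define f where "f = Abs_poly (\<lambda>i. if i \<le> degree p then \<alpha> i else 0)"
    have f: "coeff p i - const (coeff f i) \<in> P" for i
      using \<alpha> PD(1) by (auto simp: f_def coeff_Abs_poly_If_le const_hom coeff_eq_0)
    have "poly (p - map_poly const f) x \<in> P"
      by (rule prime_ideal_poly[OF P(1)]) (simp add: coeff_map_poly const_hom f)
    then have "poly (map_poly const f) x \<in> P"
      using pq(2) PD(7) by fastforce
    then have "f = 0" using nonzero_complex_poly_notin_prime_ideal[OF P(1) xP] by blast
    then have "coeff p i \<in> P" for i using f[of i] by (simp add: const_hom)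
    then have "poly (formal_deriv p) x \<in> P"
      by (intro prime_ideal_poly[OF P(1)]) (simp add: coeff_formal_deriv PD(5) del: of_nat_Suc)
    then show False using d P(2) PD(4) by blast
  qed
  then show ?thesis
    using dual_subring_adjoin[OF dual_subring_constants, of x t]
      adjoin_contains(1)[OF dual_subring_constants, of x t]
    by (simp add: partial_derivation_def)
qed

lemma partial_derivation_Union:
  assumes "C \<noteq> {}" "subset.chain {G. partial_derivation G} C"
  shows "partial_derivation (\<Union>C)"
proof -
  have pd: "partial_derivation G" if "G \<in> C" for G
    using assms(2) that by (auto simp: subset.chain_def)
  obtain G0 where G0: "G0 \<in> C" using assms(1) by blast
  have "(a + b, d + e) \<in> \<Union>C \<and> (a * b, a * e + d * b) \<in> \<Union>C"
    if ab: "(a, d) \<in> \<Union>C" "(b, e) \<in> \<Union>C" for a d b e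
  proof -
    obtain X Y where XY: "X \<in> C" "Y \<in> C" "(a, d) \<in> X" "(b, e) \<in> Y" using ab by blast
    then have "X \<subseteq> Y \<or> Y \<subseteq> X" using assms(2) by (auto simp: subset.chain_def)
    then obtain Z where "Z \<in> C" "(a, d) \<in> Z" "(b, e) \<in> Z" using XY by blast
    then show ?thesis
      using pd[of Z] dual_subringD(3,4)[of Z] unfolding partial_derivation_def by blast
  qed
  moreover have "(1, 0) \<in> \<Union>C" "(- 1, 0) \<in> \<Union>C" "constants \<times> {0} \<subseteq> \<Union>C"
    using G0 pd[OF G0] unfolding partial_derivation_def dual_subring_def by blast+
  moreover have "d = 0" if "(0, d) \<in> \<Union>C" for d
    using pd that unfolding partial_derivation_def by blast
  ultimately show ?thesis unfolding partial_derivation_def dual_subring_def by blast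
qed

text \<open>
  The graph of the required derivation is a maximal partial derivation through \<open>(x, t)\<close>: by
  \<open>partial_derivation_adjoin\<close> it is defined on the whole algebra.
\<close>

lemma derivation_exists:
  assumes t: "t * t = t" and nc: "nowhere_constant_on x t"
  shows "\<exists>D. derivation cscale D \<and> D x = t"
proof -
  define \<G> where "\<G> = {G. partial_derivation G \<and> (x, t) \<in> G}"
  have "adjoin (constants \<times> {0}) x t \<in> \<G>"
    using partial_derivation_initial[OF t nc] adjoin_contains(2)[OF dual_subring_constants]
    by (simp add: \<G>_def)
  then have "\<G> \<noteq> {}" by blast
  moreover have "\<Union>C \<in> \<G>" if C: "C \<noteq> {}" "subset.chain \<G> C" for C
  proof -
    have "subset.chain {G. partial_derivation G} C"
      using C(2) by (auto simp: subset.chain_def \<G>_def)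
    moreover have "(x, t) \<in> \<Union>C" using C by (auto simp: subset.chain_def \<G>_def)
    ultimately show ?thesis using partial_derivation_Union[OF C(1)] by (simp add: \<G>_def)
  qed
  ultimately obtain G where G: "G \<in> \<G>" and max: "\<And>X. X \<in> \<G> \<Longrightarrow> G \<subseteq> X \<Longrightarrow> X = G"
    using subset_Zorn_nonempty[of \<G>] by blast
  have pd: "partial_derivation G" and xt: "(x, t) \<in> G" using G by (auto simp: \<G>_def)
  have Gr: "dual_subring G" using pd by (simp add: partial_derivation_def)
  have "\<exists>d. (y, d) \<in> G" for y
  proof -
    obtain z where z: "partial_derivation (adjoin G y z)"
      using partial_derivation_adjoin[OF pd] by blast
    then have "adjoin G y z = G"
      using xt adjoin_contains(1)[OF Gr, of y z] by (intro max) (auto simp: \<G>_def)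
    then show ?thesis using adjoin_contains(2)[OF Gr, of y z] by auto
  qed
  then obtain D where D: "\<And>y. (y, D y) \<in> G" by metis
  have unique: "D y = d" if "(y, d) \<in> G" for y d
    using dual_subringD(5)[OF Gr D[of y] that] pd unfolding partial_derivation_def by auto
  have add: "D (a + b) = D a + D b" and mult: "D (a * b) = D a * b + a * D b" for a b
    using unique dual_subringD(3,4)[OF Gr D[of a] D[of b]] by (auto simp: add.commute)
  have "D (const \<alpha>) = 0" for \<alpha>
    using pd const_in_constants[of \<alpha>] by (intro unique) (auto simp: partial_derivation_def)
  then have "D (cscale \<alpha> a) = cscale \<alpha> (D a)" for \<alpha> a
    using mult[of "const \<alpha>" a] by (simp add: cscale_eq[of \<alpha> a] cscale_eq[of \<alpha> "D a"])
  then have "derivation cscale D"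
    using add mult vector_space_axioms by (simp add: derivation_def Vector_Spaces.linear_iff)
  then show ?thesis using unique[OF xt] by blast
qed


section \<open>Countably valued elements\<close>

lemma derivationD:
  assumes "derivation cscale D"
  shows "D (a + b) = D a + D b" "D (cscale \<alpha> a) = cscale \<alpha> (D a)" "D (a * b) = D a * b + a * D b"
    "D 0 = 0" "D (a - b) = D a - D b" "D (sum g I) = (\<Sum>i\<in>I. D (g i))"
proof -
  show *: "D (a + b) = D a + D b" "D (cscale \<alpha> a) = cscale \<alpha> (D a)" "D (a * b) = D a * b + a * D b" for a b \<alpha>
    using assms by (auto simp: derivation_def Vector_Spaces.linear_iff)
  show z: "D 0 = 0" using *(1)[of 0 0] by simp
  show "D (a - b) = D a - D b" using *(1)[of "a - b" b] by simp
  show "D (sum g I) = (\<Sum>i\<in>I. D (g i))"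
    by (induction I rule: infinite_finite_induct) (simp_all add: z *(1))
qed

lemma derivation_idempotent:
  assumes D: "derivation cscale D" and e: "e * e = e"
  shows "D e = 0"
proof -
  have 1: "D e = D e * e + e * D e" using derivationD(3)[OF D, of e e] e by simp
  then have "e * D e = e * D e + e * D e"
    using e by (metis distrib_left mult.assoc mult.commute)
  then have "e * D e = 0" by simp
  then show ?thesis using 1 by (simp add: mult.commute)
qed

lemma derivation_supp:
  assumes D: "derivation cscale D"
  shows "supp a * D a = D a"
  using derivationD(3)[OF D, of "supp a" a] derivation_idempotent[OF D supp_idem]
  by (simp add: supp_mult)

text \<open>
  Derivations kill the partial sums and are contractive, hence they kill the limits of partial sums.
\<close>

lemma derivation_countably_valued:
  assumes D: "derivation cscale D" and a: "a \<in> countably_valued cscale \<mu>"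
  shows "D a = 0"
proof -
  note DD = derivationD[OF D]
  have step: "D (\<Sum>k<n. cscale (\<alpha> k) (e k)) = 0" if "\<forall>k<n. e k \<in> idempotents" for n :: nat and \<alpha> e
    using that derivation_idempotent[OF D] by (simp add: DD(2,6) idempotents_iff)
  show ?thesis
    using a unfolding countably_valued_def limitin_iff_tends
  proof (elim UnE CollectE exE conjE)
    fix n :: nat and \<alpha> e
    assume "\<forall>k<n. e k \<in> idempotents" "a = (\<Sum>k<n. cscale (\<alpha> k) (e k))"
    then show ?thesis using step by simp
  next
    fix \<alpha> and e :: "nat \<Rightarrow> 'a"
    assume e: "\<forall>k. e k \<in> idempotents" and lim: "tends (\<lambda>n. \<Sum>k<n. cscale (\<alpha> k) (e k)) a"
    define s where "s n = (\<Sum>k<n. cscale (\<alpha> k) (e k))" for n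
    have Ds: "D (s n) = 0" for n unfolding s_def using e by (intro step) simp
    have "nrm (0 - D a) \<le> nrm (s n - a)" for n
      using nrm_le_nrm[OF derivation_supp[OF D, of "s n - a"]] by (simp add: DD(5) Ds)
    then have "tends (\<lambda>_. 0) (D a)"
      using tends_contraction[of s a "\<lambda>_. 0" "D a"] lim unfolding s_def by blast
    moreover have "tends (\<lambda>_. 0) 0"
      by (simp add: tends_def nrm_idempotent finite_measure_on_idempotents_zero[OF meas])
    ultimately show ?thesis using tends_unique[of "\<lambda>_. 0" "D a" "\<lambda>_. 0" 0] by simp
  qed
qed

text \<open>
  For each \<open>\<alpha>\<close> there is a largest idempotent \<open>g \<alpha>\<close> on which \<open>x\<close> equals \<open>\<alpha>\<close>. These idempotents are disjoint,
  so finiteness of the measure leaves only countably many non-zero ones, and \<open>c\<close> is their sum.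
\<close>

lemma countably_valued_part:
  "\<exists>c. c * c = c \<and> c * x \<in> countably_valued cscale \<mu> \<and> nowhere_constant_on x (1 - c)"
proof -
  define g where "g \<alpha> = 1 - supp (x - const \<alpha>)" for \<alpha>
  have gg: "g \<alpha> * g \<alpha> = g \<alpha>" for \<alpha> by (simp add: g_def algebra_simps supp_idem)
  have gx: "g \<alpha> * x = const \<alpha> * g \<alpha>" for \<alpha>
  proof -
    have "g \<alpha> * (x - const \<alpha>) = 0" by (simp add: g_def left_diff_distrib supp_mult)
    then show ?thesis by (simp add: right_diff_distrib mult.commute)
  qed
  have gmax: "f * g \<alpha> = f" if f: "f * f = f" "f * x = cscale \<alpha> f" for f \<alpha>
  proof -
    have "(1 - f) * (x - const \<alpha>) = x - const \<alpha>"
      using f(2) by (simp add: algebra_simps cscale_eq[of \<alpha> f])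
    moreover have "(1 - f) * (1 - f) = 1 - f" using f(1) by (simp add: algebra_simps)
    ultimately have "supp (x - const \<alpha>) * (1 - f) = supp (x - const \<alpha>)" by (intro supp_least)
    then show ?thesis by (simp add: g_def algebra_simps)
  qed
  have disj: "g \<alpha> * g \<beta> = 0" if "\<alpha> \<noteq> \<beta>" for \<alpha> \<beta>
  proof -
    have "const \<alpha> * (g \<alpha> * g \<beta>) = const \<beta> * (g \<alpha> * g \<beta>)"
      using gx by (metis mult.assoc mult.commute)
    then have z: "const (\<alpha> - \<beta>) * (g \<alpha> * g \<beta>) = 0" by (simp add: const_hom(2) left_diff_distrib)
    obtain r where r: "1 = const (\<alpha> - \<beta>) * r"
      using const_dvd_1[of "\<alpha> - \<beta>"] \<open>\<alpha> \<noteq> \<beta>\<close> unfolding dvd_def right_minus_eq by blast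
    have "g \<alpha> * g \<beta> = const (\<alpha> - \<beta>) * r * (g \<alpha> * g \<beta>)" using r by simp
    also have "\<dots> = r * (const (\<alpha> - \<beta>) * (g \<alpha> * g \<beta>))" by (simp only: ac_simps)
    finally show ?thesis using z by simp
  qed
  define B where "B = {\<alpha>. g \<alpha> \<noteq> 0}"
  have sum_le: "(\<Sum>\<alpha>\<in>F. \<mu> (g \<alpha>)) \<le> \<mu> 1" if "finite F" for F
  proof -
    have *: "sum g F * sum g F = sum g F \<and> \<mu> (sum g F) = (\<Sum>\<alpha>\<in>F. \<mu> (g \<alpha>))"
      using that gg disj by (intro mu_sum_disjoint)
    then show ?thesis using mu_mono[of "sum g F" 1] by simp
  qed
  have "(\<lambda>\<alpha>. \<mu> (g \<alpha>)) summable_on UNIV"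
    by (rule nonneg_bdd_above_summable_on) (auto simp: mu_nonneg gg intro!: bdd_aboveI2 sum_le)
  then have "countable {\<alpha>\<in>UNIV. \<mu> (g \<alpha>) \<noteq> 0}" by (rule summable_countable_real)
  moreover have "B \<subseteq> {\<alpha>\<in>UNIV. \<mu> (g \<alpha>) \<noteq> 0}"
    using nrm_eq_0 nrm_idempotent[OF gg] by (auto simp: B_def)
  ultimately have "countable B" by (rule countable_subset[rotated])
  then obtain h :: "complex \<Rightarrow> nat" where h: "inj_on h B" by (auto simp: countable_def)
  define \<alpha> where "\<alpha> = inv_into B h"
  \<comment> \<open>an enumeration of the non-zero \<open>g \<alpha>\<close>, padded by zeros at indices outside the range of \<open>h\<close>\<close>
  define e where "e k = (if k \<in> h ` B then g (\<alpha> k) else 0)" for k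
  have ee: "e k * e k = e k" for k by (simp add: e_def gg)
  have edisj: "e j * e k = 0" if "j \<noteq> k" for j k
  proof (cases "j \<in> h ` B \<and> k \<in> h ` B")
    case True
    then have "\<alpha> j \<noteq> \<alpha> k" using that unfolding \<alpha>_def by (metis f_inv_into_f)
    then show ?thesis using True disj by (simp add: e_def)
  qed (auto simp: e_def)
  have ex: "e k * x = cscale (\<alpha> k) (e k)" for k
    by (auto simp: e_def gx cscale_eq[of "\<alpha> k" "g (\<alpha> k)"])
  define u where "u n = (\<Sum>k<n. e k)" for n
  have eu: "e k * u n = e k" if "k < n" for k n
  proof -
    have "e k * u n = (\<Sum>j<n. if j = k then e k else 0)"
      unfolding u_def sum_distrib_left using edisj ee by (intro sum.cong) auto
    then show ?thesis using that by simp
  qed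
  have part: "sum e I * sum e I = sum e I \<and> \<mu> (sum e I) = (\<Sum>k\<in>I. \<mu> (e k))" if "finite I" for I
    using that ee edisj by (intro mu_sum_disjoint)
  have "summable (\<lambda>k. \<mu> (e k))"
  proof (rule summableI_nonneg_bounded)
    show "0 \<le> \<mu> (e k)" for k by (simp add: mu_nonneg ee)
    show "(\<Sum>k<n. \<mu> (e k)) \<le> \<mu> 1" for n
      using part[of "{..<n}"] mu_mono[of "sum e {..<n}" 1] by simp
  qed
  then have lim: "(\<lambda>n. \<mu> (u n)) \<longlonglongrightarrow> (\<Sum>k. \<mu> (e k))"
    using part[of "{..<_}"] summable_LIMSEQ by (simp add: u_def)
  define \<beta> where "\<beta> n = \<bar>\<mu> (u n) - (\<Sum>k. \<mu> (e k))\<bar>" for n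
  have \<beta>: "\<beta> \<longlonglongrightarrow> 0"
    unfolding \<beta>_def using lim by (simp add: LIM_zero tendsto_rabs_zero)
  have diff: "nrm (u n - u m) = \<mu> (u n) - \<mu> (u m)" if "m \<le> n" for m n
  proof -
    have "u n = u m + sum e {m..<n}" "(\<Sum>k<n. \<mu> (e k)) = (\<Sum>k<m. \<mu> (e k)) + (\<Sum>k=m..<n. \<mu> (e k))"
      unfolding u_def using that sum.atLeastLessThan_concat[of 0 m n e]
        sum.atLeastLessThan_concat[of 0 m n "\<lambda>k. \<mu> (e k)"]
      by (simp_all add: atLeast0LessThan)
    then show ?thesis using part[of "{m..<n}"] part[of "{..<n}"] part[of "{..<m}"]
      by (simp add: nrm_idempotent u_def)
  qed
  have "nrm (u m - u n) \<le> \<beta> m + \<beta> n" for m n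
  proof (cases "m \<le> n")
    case True
    then show ?thesis using diff[OF True] nrm_minus[of "u m - u n"] by (simp add: \<beta>_def)
  next
    case False
    then show ?thesis using diff[of n m] by (simp add: \<beta>_def)
  qed
  then obtain c where c: "tends u c" using tends_Cauchy[OF _ \<beta>] by blast
  have ec: "e k * c = e k" for k
  proof (rule tends_unique)
    show "tends (\<lambda>n. e k * u n) (e k * c)" by (rule tends_mult[OF c])
    show "tends (\<lambda>_. e k) (e k)"
      by (simp add: tends_def nrm_idempotent finite_measure_on_idempotents_zero[OF meas])
    show "eventually (\<lambda>n. e k * u n = e k) sequentially"
      using eventually_gt_at_top[of k] by eventually_elim (rule eu)
  qed
  have "c * u n = u n" for n
    unfolding u_def sum_distrib_left by (simp add: mult.commute[of c] ec)
  then have "c * c = c"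
    using tends_unique[OF tends_mult[OF c, of c] c] by simp
  moreover have "c * x \<in> countably_valued cscale \<mu>"
  proof -
    have "x * u n = (\<Sum>k<n. cscale (\<alpha> k) (e k))" for n
      unfolding u_def sum_distrib_left by (simp add: mult.commute[of x] ex)
    then have "tends (\<lambda>n. \<Sum>k<n. cscale (\<alpha> k) (e k)) (c * x)"
      using tends_mult[OF c, of x] by (simp add: mult.commute)
    then show ?thesis
      unfolding countably_valued_def limitin_iff_tends using ee edisj
      by (intro UnI2 CollectI exI[of _ \<alpha>] exI[of _ e]) (simp add: idempotents_iff)
  qed
  moreover have "f = 0" if f: "f * f = f" "f * (1 - c) = f" "f * x = cscale \<gamma> f" for \<gamma> f
  proof (rule ccontr)
    assume "f \<noteq> 0"
    have fg: "f * g \<gamma> = f" using gmax[OF f(1,3)] .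
    then have "\<gamma> \<in> B" using \<open>f \<noteq> 0\<close> by (auto simp: B_def)
    then have "e (h \<gamma>) = g \<gamma>" using h by (simp add: e_def \<alpha>_def)
    then have "f = f * (e (h \<gamma>) * c)" using fg unfolding ec by simp
    also have "\<dots> = e (h \<gamma>) * (f * c)" by (simp only: ac_simps)
    also have "f * c = 0" using f(2) by (simp add: right_diff_distrib)
    finally show False using \<open>f \<noteq> 0\<close> by simp
  qed
  ultimately show ?thesis unfolding nowhere_constant_on_def by blast
qed


section \<open>Local derivations\<close>

text \<open>
  At \<open>y\<close> both \<open>D\<close> and \<open>D \<circ> D\<close> vanish on the countably valued part of \<open>y\<close>, and on the complementary
  part some derivation takes the value \<open>1\<close> at \<open>y\<close>; a multiple of the latter agrees with \<open>D \<circ> D\<close> at \<open>y\<close>.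
\<close>

lemma derivation_composition_local:
  assumes D: "derivation cscale D"
  shows "local_derivation cscale (D \<circ> D)"
  unfolding local_derivation_def
proof (intro conjI allI)
  note DD = derivationD[OF D]
  show "Vector_Spaces.linear cscale cscale (D \<circ> D)"
    using vector_space_axioms by (simp add: Vector_Spaces.linear_iff DD)
  fix y
  obtain c where c: "c * c = c" "c * y \<in> countably_valued cscale \<mu>"
    "nowhere_constant_on y (1 - c)"
    using countably_valued_part[of y] by blast
  have c1: "(1 - c) * (1 - c) = 1 - c" using c(1) by (simp add: algebra_simps)
  obtain E where E: "derivation cscale E" "E y = 1 - c"
    using derivation_exists[OF c1 c(3)] by blast
  have Dc: "D c = 0" by (rule derivation_idempotent[OF D c(1)])
  have "D (c * y) = 0" by (rule derivation_countably_valued[OF D c(2)])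
  then have "c * D y = 0" by (simp add: DD(3) Dc)
  then have "D (c * D y) = 0" by (simp add: DD(4))
  then have cDD: "c * D (D y) = 0" by (simp add: DD(3) Dc)
  note EE = derivationD[OF E(1)]
  have "derivation cscale (\<lambda>a. D (D y) * E a)"
    using vector_space_axioms
    by (simp add: derivation_def Vector_Spaces.linear_iff EE(1-3) cscale_eq[of _ "E _"]
        cscale_eq[of _ "_ * _"] algebra_simps)
  moreover have "(D \<circ> D) y = D (D y) * E y"
    using cDD by (simp add: E(2) algebra_simps)
  ultimately show "\<exists>D'. derivation cscale D' \<and> (D \<circ> D) y = D' y" by blast
qed

text \<open>
  The Leibniz rule for \<open>D \<circ> D\<close> at \<open>(x, x)\<close> would force \<open>2 (D x)\<^sup>2 = 0\<close>, but a regular ring is reduced.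
\<close>

lemma derivation_composition_not_derivation:
  assumes D: "derivation cscale D" and "D x \<noteq> 0"
  shows "\<not> derivation cscale (D \<circ> D)"
proof
  assume DD: "derivation cscale (D \<circ> D)"
  have "(D \<circ> D) (x * x) = D (D x) * x + x * D (D x) + (D x * D x + D x * D x)"
    by (simp only: o_apply derivationD(1,3)[OF D]) (simp add: algebra_simps)
  then have "of_nat 2 * (D x * D x) = 0"
    using derivationD(3)[OF DD, of x x] by (simp add: algebra_simps)
  moreover obtain r where "1 = of_nat 2 * (r::'a)"
    using const_dvd_1[of 2] of_nat_eq_const[of 2] unfolding dvd_def by auto
  ultimately have "D x * D x = 0" by (metis mult.assoc mult.commute mult_1 mult_zero_left)
  moreover obtain b where "D x = D x * b * D x"
    using reg unfolding von_neumann_regular_def by blast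
  ultimately show False using \<open>D x \<noteq> 0\<close> by (metis mult.assoc mult.commute mult_zero_left)
qed

lemma nonzero_derivation_exists:
  assumes "countably_valued cscale \<mu> \<noteq> UNIV"
  shows "\<exists>D x. derivation cscale D \<and> D x \<noteq> 0"
proof -
  obtain x where x: "x \<notin> countably_valued cscale \<mu>" using assms by blast
  obtain c where c: "c * c = c" "c * x \<in> countably_valued cscale \<mu>"
    "nowhere_constant_on x (1 - c)"
    using countably_valued_part[of x] by blast
  have "(1 - c) * (1 - c) = 1 - c" using c(1) by (simp add: algebra_simps)
  moreover have "1 - c \<noteq> 0" using c(2) x by auto
  ultimately show ?thesis using derivation_exists[OF _ c(3)] by metis
qed

end


theorem theorem3p5:
  fixes cscale :: "complex \<Rightarrow> 'a::comm_ring_1 \<Rightarrow> 'a"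
    and \<mu> :: "'a \<Rightarrow> real"
  assumes "complex_algebra cscale"
    and "von_neumann_regular TYPE('a)"
    and "finite_measure_on_idempotents \<mu>"
    and "strictly_positive \<mu>"
    and "Metric_space.mcomplete UNIV (rho \<mu>)"
  shows "(countably_valued cscale \<mu> \<noteq> UNIV \<longleftrightarrow>
           (\<exists>D. derivation cscale D \<and> D \<noteq> (\<lambda>x. 0))) \<and>
         ((\<exists>D. derivation cscale D \<and> D \<noteq> (\<lambda>x. 0)) \<longleftrightarrow>
           (\<exists>\<Delta>. local_derivation cscale \<Delta> \<and> \<Delta> \<noteq> (\<lambda>x. 0))) \<and>
         ((\<exists>\<Delta>. local_derivation cscale \<Delta> \<and> \<Delta> \<noteq> (\<lambda>x. 0)) \<longleftrightarrow>
           (\<exists>\<Delta>. local_derivation cscale \<Delta> \<and> \<not> derivation cscale \<Delta>))"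
proof -
  interpret complete_regular_algebra cscale \<mu>
    using assms by (simp add: complete_regular_algebra_def complete_regular_algebra_axioms_def)
  define i where "i \<longleftrightarrow> countably_valued cscale \<mu> \<noteq> UNIV"
  define ii where "ii \<longleftrightarrow> (\<exists>D. derivation cscale D \<and> D \<noteq> (\<lambda>x. 0))"
  define iii where "iii \<longleftrightarrow> (\<exists>\<Delta>. local_derivation cscale \<Delta> \<and> \<Delta> \<noteq> (\<lambda>x. 0))"
  define iv where "iv \<longleftrightarrow> (\<exists>\<Delta>. local_derivation cscale \<Delta> \<and> \<not> derivation cscale \<Delta>)"
  have "iv" if "i"
    using nonzero_derivation_exists derivation_composition_local derivation_composition_not_derivation that
    unfolding i_def iv_def by metis
  moreover have "iii" if "iv"
  proof -
    have "derivation cscale (\<lambda>x. 0)"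
      using vector_space_axioms by (simp add: derivation_def Vector_Spaces.linear_iff)
    then show ?thesis using that unfolding iii_def iv_def by metis
  qed
  moreover have "ii" if "iii"
  proof -
    obtain \<Delta> y where \<Delta>: "local_derivation cscale \<Delta>" "\<Delta> y \<noteq> 0"
      using \<open>iii\<close> unfolding iii_def by (auto simp: fun_eq_iff)
    then obtain D where "derivation cscale D" "D y \<noteq> 0"
      unfolding local_derivation_def by metis
    then show ?thesis unfolding ii_def by (auto simp: fun_eq_iff)
  qed
  moreover have "i" if "ii"
    using that derivation_countably_valued unfolding i_def ii_def by (auto simp: fun_eq_iff)
  ultimately show ?thesis unfolding i_def ii_def iii_def iv_def by argo
qed

end
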